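(* Let $B$ be a connected left regular band, let $G$ be a finite group acting on $B$ by semigroup automorphisms, and let $\mathbf{k}$ be a field whose characteristic does not divide $|G|$. The following are equivalent: (1) the invariant subalgebra $(\mathbf{k} B)^G$ is semisimple; (2) $|\Lambda(B)/G|=|B/G|$; (3) the invariant subalgebra $(\mathbf{k} B)^G$ is commutative.
   Context: A left regular band (LRB) is a finite semigroup $B$ satisfying $x^2=x$ and $xyx=xy$ for all $x,y\in B$. For $b\in B$ let $\sigma(b)=Bb$; the set $\Lambda(B)$ of principal left ideals ordered by inclusion is a meet-semilattice (the support semilattice). The semigroup order on $B$ is $x\le y$ iff $yx=x$. For $X\in\Lambda(B)$, $B_{\ge X}=\{b\in B:\sigma(b)\ge X\}$; $B$ is connected if the Hasse diagram of every $B_{\ge X}$ is connected. $\mathbf{k} B$ is the semigroup algebra; $G$ acts on $\mathbf{k} B$ by extending linearly, and on $\Lambda(B)$ by $g(Bb)=Bg(b)$. $(\mathbf{k} B)^G$ is the subalgebra of $G$-fixed elements; $B/G$ and $\Lambda(B)/G$ are the sets of $G$-orbits. *)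

theory Defs
  imports
    "HOL-Algebra.Group_Action"
    "HOL-Algebra.AbelCoset"
begin

section \<open>Left regular bands\<close>

locale left_regular_band =
  fixes B :: "'b set" and bmul :: "'b \<Rightarrow> 'b \<Rightarrow> 'b" (infixl "\<cdot>" 70)
  assumes finite_carrier: "finite B"
    and closed: "x \<in> B \<Longrightarrow> y \<in> B \<Longrightarrow> x \<cdot> y \<in> B"
    and assoc: "x \<in> B \<Longrightarrow> y \<in> B \<Longrightarrow> z \<in> B \<Longrightarrow> (x \<cdot> y) \<cdot> z = x \<cdot> (y \<cdot> z)"
    and idem: "x \<in> B \<Longrightarrow> x \<cdot> x = x"
    and left_regular: "x \<in> B \<Longrightarrow> y \<in> B \<Longrightarrow> x \<cdot> y \<cdot> x = x \<cdot> y"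

definition support :: "'b set \<Rightarrow> ('b \<Rightarrow> 'b \<Rightarrow> 'b) \<Rightarrow> 'b \<Rightarrow> 'b set" where
  "support B bmul b = {bmul x b | x. x \<in> B}"

definition support_semilattice :: "'b set \<Rightarrow> ('b \<Rightarrow> 'b \<Rightarrow> 'b) \<Rightarrow> 'b set set" where
  "support_semilattice B bmul = support B bmul ` B"

definition lrb_le :: "('b \<Rightarrow> 'b \<Rightarrow> 'b) \<Rightarrow> 'b \<Rightarrow> 'b \<Rightarrow> bool" where
  "lrb_le bmul x y \<longleftrightarrow> bmul y x = x"

definition lrb_less :: "('b \<Rightarrow> 'b \<Rightarrow> 'b) \<Rightarrow> 'b \<Rightarrow> 'b \<Rightarrow> bool" where
  "lrb_less bmul x y \<longleftrightarrow> lrb_le bmul x y \<and> x \<noteq> y"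

definition cover_relation :: "('b \<Rightarrow> 'b \<Rightarrow> 'b) \<Rightarrow> 'b set \<Rightarrow> ('b \<times> 'b) set" where
  "cover_relation bmul P =
     {(x, y). x \<in> P \<and> y \<in> P \<and> lrb_less bmul x y \<and>
        \<not> (\<exists>z\<in>P. lrb_less bmul x z \<and> lrb_less bmul z y)}"

definition hasse_connected :: "('b \<Rightarrow> 'b \<Rightarrow> 'b) \<Rightarrow> 'b set \<Rightarrow> bool" where
  "hasse_connected bmul P \<longleftrightarrow>
     (\<forall>x\<in>P. \<forall>y\<in>P. (x, y) \<in> (cover_relation bmul P \<union> (cover_relation bmul P)\<inverse>)\<^sup>*)"

definition upper_part :: "'b set \<Rightarrow> ('b \<Rightarrow> 'b \<Rightarrow> 'b) \<Rightarrow> 'b set \<Rightarrow> 'b set" where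
  "upper_part B bmul X = {b \<in> B. X \<subseteq> support B bmul b}"

locale connected_left_regular_band = left_regular_band +
  assumes connected:
    "X \<in> support_semilattice B bmul \<Longrightarrow> hasse_connected bmul (upper_part B bmul X)"

section \<open>Actions by semigroup automorphisms\<close>

locale lrb_group_action = left_regular_band B bmul + group_action G B \<phi>
  for B :: "'b set" and bmul :: "'b \<Rightarrow> 'b \<Rightarrow> 'b" (infixl "\<cdot>" 70)
    and G :: "('g, 'm) monoid_scheme" (structure) and \<phi> :: "'g \<Rightarrow> 'b \<Rightarrow> 'b" +
  assumes action_mult:
    "g \<in> carrier G \<Longrightarrow> x \<in> B \<Longrightarrow> y \<in> B \<Longrightarrow> \<phi> g (x \<cdot> y) = \<phi> g x \<cdot> \<phi> g y"

text \<open>The induced action \<open>g(Bb) = Bg(b)\<close>; it does not depend on the representative \<open>b\<close>,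
  see \<open>support_action_support\<close> below.\<close>

definition support_action ::
    "'b set \<Rightarrow> ('b \<Rightarrow> 'b \<Rightarrow> 'b) \<Rightarrow> ('g \<Rightarrow> 'b \<Rightarrow> 'b) \<Rightarrow> 'g \<Rightarrow> 'b set \<Rightarrow> 'b set" where
  "support_action B bmul \<phi> g =
     (\<lambda>X \<in> support_semilattice B bmul.
        THE Y. \<exists>b\<in>B. X = support B bmul b \<and> Y = support B bmul (\<phi> g b))"

lemma (in lrb_group_action) support_action_image:
  assumes g: "g \<in> carrier G" and b: "b \<in> B"
  shows "support B bmul (\<phi> g b) = \<phi> g ` support B bmul b"
proof -
  have surj: "\<phi> g ` B = B"
    using surj_prop[OF g] .
  have "\<phi> g ` support B bmul b = {\<phi> g x \<cdot> \<phi> g b | x. x \<in> B}"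
    using action_mult[OF g _ b] by (auto simp: support_def image_def)
  also have "\<dots> = {y \<cdot> \<phi> g b | y. y \<in> \<phi> g ` B}"
    by auto
  finally show ?thesis
    by (simp add: surj support_def)
qed

lemma (in lrb_group_action) support_action_support:
  assumes g: "g \<in> carrier G" and b: "b \<in> B"
  shows "support_action B bmul \<phi> g (support B bmul b) = support B bmul (\<phi> g b)"
proof -
  have "(THE Y. \<exists>c\<in>B. support B bmul b = support B bmul c \<and> Y = support B bmul (\<phi> g c))
      = support B bmul (\<phi> g b)"
    using b by (intro the_equality) (auto simp: support_action_image[OF g])
  then show ?thesis
    using b by (simp add: support_action_def support_semilattice_def)
qed

section \<open>The semigroup algebra and its invariants\<close>

text \<open>Elements are the \<open>'k\<close>-valued functions supported on \<open>B\<close>, with \<open>f\<close> standing for the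
  formal sum of the \<open>f b \<cdot> b\<close>.  The identity element need not be an element of \<open>B\<close>, and without
  connectedness need not exist at all, in which case the field \<open>one\<close> is meaningless.
  When it exists it is unique, hence fixed by automorphisms, and is the identity of the invariants.\<close>

definition semigroup_algebra ::
    "'b set \<Rightarrow> ('b \<Rightarrow> 'b \<Rightarrow> 'b) \<Rightarrow> ('b \<Rightarrow> 'k::field) ring" where
  "semigroup_algebra B bmul =
    (let A = {f. \<forall>b. b \<notin> B \<longrightarrow> f b = 0};
         m = (\<lambda>f h c. \<Sum>(a, b) \<in> {(a, b). a \<in> B \<and> b \<in> B \<and> bmul a b = c}. f a * h b)
     in \<lparr>carrier = A, monoid.mult = m,
         one = (THE e. e \<in> A \<and> (\<forall>f\<in>A. m e f = f \<and> m f e = f)),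
         zero = (\<lambda>b. 0), add = (\<lambda>f h b. f b + h b)\<rparr>)"

text \<open>The linear extension of \<open>u : B \<rightarrow> B\<close>, sending \<open>\<Sum> f b \<cdot> b\<close> to \<open>\<Sum> f b \<cdot> u b\<close>.\<close>

definition linear_extension :: "'b set \<Rightarrow> ('b \<Rightarrow> 'b) \<Rightarrow> ('b \<Rightarrow> 'k::field) \<Rightarrow> 'b \<Rightarrow> 'k" where
  "linear_extension B u f c = (\<Sum>b \<in> {b \<in> B. u b = c}. f b)"

definition invariant_algebra ::
    "'b set \<Rightarrow> ('b \<Rightarrow> 'b \<Rightarrow> 'b) \<Rightarrow> ('g, 'm) monoid_scheme \<Rightarrow> ('g \<Rightarrow> 'b \<Rightarrow> 'b) \<Rightarrow>
      ('b \<Rightarrow> 'k::field) ring" where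
  "invariant_algebra B bmul G \<phi> =
     (semigroup_algebra B bmul)
       \<lparr>carrier := {f \<in> carrier (semigroup_algebra B bmul).
                     \<forall>g \<in> carrier G. linear_extension B (\<phi> g) f = f}\<rparr>"

section \<open>Semisimple rings\<close>

definition left_ideal :: "'a set \<Rightarrow> ('a, 'm) ring_scheme \<Rightarrow> bool" where
  "left_ideal I R \<longleftrightarrow>
     additive_subgroup I R \<and> (\<forall>r \<in> carrier R. \<forall>x \<in> I. r \<otimes>\<^bsub>R\<^esub> x \<in> I)"

definition simple_left_ideal :: "'a set \<Rightarrow> ('a, 'm) ring_scheme \<Rightarrow> bool" where
  "simple_left_ideal I R \<longleftrightarrow>
     left_ideal I R \<and> I \<noteq> {\<zero>\<^bsub>R\<^esub>} \<and>
     (\<forall>J. left_ideal J R \<longrightarrow> J \<subseteq> I \<longrightarrow> J = {\<zero>\<^bsub>R\<^esub>} \<or> J = I)"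

text \<open>The left regular module is a direct sum of simple modules.  Finite families suffice, as the
  ring is unital; distinct members of the family are automatically distinct ideals.  For a unital
  \<open>k\<close>-algebra the left ideals of the ring are exactly the submodules of the regular module.\<close>

definition semisimple_ring :: "('a, 'm) ring_scheme \<Rightarrow> bool" where
  "semisimple_ring R \<longleftrightarrow>
     ring R \<and>
     (\<exists>\<L>. finite \<L> \<and> (\<forall>L\<in>\<L>. simple_left_ideal L R) \<and>
        (\<forall>x \<in> carrier R. \<exists>!y. y \<in> (\<Pi>\<^sub>E L\<in>\<L>. L) \<and> x = finsum R y \<L>))"

definition commutative_ring :: "('a, 'm) ring_scheme \<Rightarrow> bool" where
  "commutative_ring R \<longleftrightarrow> (\<forall>x \<in> carrier R. \<forall>y \<in> carrier R. x \<otimes>\<^bsub>R\<^esub> y = y \<otimes>\<^bsub>R\<^esub> x)"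

end

theory Submission
  imports Defs
begin

text \<open>For \<open>y \<in> B\<close> the sum of the coefficients of \<open>f\<close> at the elements of support at least \<open>\<sigma>(y)\<close> is a
  character of \<open>kB\<close>, and the common kernel of these characters is a nilpotent ideal. They
  separate the elements of \<open>(kB)\<^sup>G\<close> precisely when every support class lies in one
  orbit, that is, when \<open>|\<Lambda>(B)/G| = |B/G|\<close>; then \<open>(kB)\<^sup>G\<close> is a product of copies
  of \<open>k\<close>, one for each orbit. If instead \<open>a\<close> and \<open>b\<close> have the same support but different orbits, then
  the difference of their orbit sums is a nonzero invariant in that ideal, and the orbit sums do not
  commute. Connectedness enters only through the existence of an identity of \<open>kB\<close>.\<close>

section \<open>The support preorder\<close>

text \<open>Ordered by support, the characters form a triangular system. On invariants with
  separated orbits its diagonal entries are the sizes of the support classes, so inverting it means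
  dividing by these sizes. Such a size times the order of a point stabilizer is the order of the
  stabilizer of a support; every integer to be inverted thus comes down to a subgroup order, and
  this is how the hypothesis on the characteristic acts. The unit is the obstacle on the ring side:
  it usually lies outside \<open>B\<close>, yet the invariants must form a unital ring, and the
  decomposition of 1 is what lets semisimplicity exclude a nonzero nil left ideal. A right identity
  always exists on an upper part; making it two-sided is the hard step.\<close>

context left_regular_band
begin

text \<open>Inclusion of principal left ideals, expressed on elements
  (\<open>support_subset_iff\<close>). It is coarser than the band order \<open>lrb_le\<close>,
  which has the factors the other way round.\<close>

definition supp_le :: "'b \<Rightarrow> 'b \<Rightarrow> bool" (infix "\<lesssim>" 50) where
  "a \<lesssim> b \<longleftrightarrow> a \<cdot> b = a"

definition supp_eq :: "'b \<Rightarrow> 'b \<Rightarrow> bool" (infix "\<approx>" 50) where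
  "a \<approx> b \<longleftrightarrow> a \<lesssim> b \<and> b \<lesssim> a"

definition upper :: "'b \<Rightarrow> 'b set" where
  "upper y = {b \<in> B. y \<lesssim> b}"

lemma supp_le_refl: "a \<in> B \<Longrightarrow> a \<lesssim> a"
  by (simp add: supp_le_def idem)

lemma supp_le_trans:
  assumes "a \<in> B" "b \<in> B" "c \<in> B" "a \<lesssim> b" "b \<lesssim> c"
  shows "a \<lesssim> c"
  using assms assoc[of a b c] by (simp add: supp_le_def)

lemma mult_supp_le:
  assumes "a \<in> B" "b \<in> B"
  shows "a \<cdot> b \<lesssim> a" "a \<cdot> b \<lesssim> b"
  using assms left_regular[of a b] assoc[of a b b] by (simp_all add: supp_le_def idem)

text \<open>The support of a product is the meet of the supports; multiplicativity of the characters
  rests on this.\<close>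

lemma supp_le_mult_iff:
  assumes "y \<in> B" "a \<in> B" "b \<in> B"
  shows "y \<lesssim> a \<cdot> b \<longleftrightarrow> y \<lesssim> a \<and> y \<lesssim> b"
proof
  assume "y \<lesssim> a \<cdot> b"
  then show "y \<lesssim> a \<and> y \<lesssim> b"
    using assms closed mult_supp_le[of a b] supp_le_trans[of y "a \<cdot> b"] by blast
next
  assume "y \<lesssim> a \<and> y \<lesssim> b"
  then show "y \<lesssim> a \<cdot> b"
    using assms assoc[of y a b] by (simp add: supp_le_def)
qed

lemma support_subset_iff:
  assumes "a \<in> B" "b \<in> B"
  shows "support B bmul a \<subseteq> support B bmul b \<longleftrightarrow> a \<lesssim> b"
proof
  assume "support B bmul a \<subseteq> support B bmul b"
  moreover have "a \<in> support B bmul a"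
    using assms idem[of a] unfolding support_def by (metis (mono_tags, lifting) mem_Collect_eq)
  ultimately obtain x where "x \<in> B" "a = x \<cdot> b"
    by (auto simp: support_def)
  then show "a \<lesssim> b"
    using assms mult_supp_le by simp
next
  assume "a \<lesssim> b"
  show "support B bmul a \<subseteq> support B bmul b"
  proof
    fix z assume "z \<in> support B bmul a"
    then obtain x where x: "x \<in> B" "z = x \<cdot> a"
      by (auto simp: support_def)
    then have "z = (x \<cdot> a) \<cdot> b"
      using \<open>a \<lesssim> b\<close> assms assoc[of x a b] by (simp add: supp_le_def)
    then show "z \<in> support B bmul b"
      using x assms closed[of x a] by (auto simp: support_def)
  qed
qed

lemma support_eq_iff:
  assumes "a \<in> B" "b \<in> B"
  shows "support B bmul a = support B bmul b \<longleftrightarrow> a \<approx> b"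
  using support_subset_iff assms by (auto simp: supp_eq_def)

lemma supp_eq_refl: "a \<in> B \<Longrightarrow> a \<approx> a"
  by (simp add: supp_eq_def supp_le_refl)

lemma supp_eq_sym: "a \<approx> b \<Longrightarrow> b \<approx> a"
  by (simp add: supp_eq_def)

lemma upper_subset: "upper y \<subseteq> B"
  by (auto simp: upper_def)

lemma finite_upper: "finite (upper y)"
  using upper_subset finite_carrier finite_subset by blast

lemma upper_antimono:
  assumes "x \<in> B" "y \<in> B" "x \<lesssim> y"
  shows "upper y \<subseteq> upper x"
  using assms supp_le_trans[of x y] by (auto simp: upper_def)

text \<open>Makes \<open>card (upper x)\<close> a numerical measure for induction on supports;
  maximal supports come first.\<close>

lemma card_upper_less:
  assumes "x \<in> B" "y \<in> B" "x \<lesssim> y" "\<not> y \<lesssim> x"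
  shows "card (upper y) < card (upper x)"
proof (rule psubset_card_mono[OF finite_upper])
  have "x \<in> upper x" "x \<notin> upper y"
    using assms by (auto simp: upper_def supp_le_refl)
  then show "upper y \<subset> upper x"
    using upper_antimono assms by blast
qed

lemma card_upper_mono:
  assumes "x \<in> B" "y \<in> B" "x \<lesssim> y"
  shows "card (upper y) \<le> card (upper x)"
  using upper_antimono[OF assms] finite_upper card_mono by blast

lemma upper_closed:
  assumes "y \<in> B" "a \<in> upper y" "b \<in> upper y"
  shows "a \<cdot> b \<in> upper y"
  using assms closed supp_le_mult_iff by (auto simp: upper_def)

text \<open>A product of all elements lies below each of them in support. Results about
  \<open>upper y\<close> thereby reach all of \<open>B\<close>.\<close>

lemma least_support:
  assumes "B \<noteq> {}"
  obtains y where "y \<in> B" "upper y = B"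
proof -
  have "T \<subseteq> B \<Longrightarrow> \<exists>y\<in>B. \<forall>b\<in>T. y \<lesssim> b" if "finite T" for T
    using that
  proof (induction T rule: finite_induct)
    case empty
    then show ?case using assms by blast
  next
    case (insert x T)
    then obtain y where "y \<in> B" "\<forall>b\<in>T. y \<lesssim> b"
      by blast
    moreover have "x \<in> B" using insert.prems by blast
    ultimately have "x \<cdot> y \<in> B" "x \<cdot> y \<lesssim> x" "x \<cdot> y \<lesssim> b" if "b \<in> T" for b
      using closed mult_supp_le supp_le_trans[of "x \<cdot> y" y b] insert.prems that by blast+
    then show ?case using \<open>x \<in> B\<close> by (cases "T = {}") (use supp_le_refl in blast)+
  qed
  from this[OF finite_carrier] that show thesis
    by (force simp: upper_def)
qed

section \<open>The semigroup algebra\<close>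

definition vecs :: "'b set \<Rightarrow> ('b \<Rightarrow> 'k::field) set" where
  "vecs S = {f. \<forall>b. b \<notin> S \<longrightarrow> f b = 0}"

text \<open>An indicator replaces the constraint on the index pairs, so the two ranges of summation
  are independent and sums can be interchanged freely.\<close>

definition conv :: "('b \<Rightarrow> 'k::field) \<Rightarrow> ('b \<Rightarrow> 'k) \<Rightarrow> 'b \<Rightarrow> 'k" where
  "conv f h c = (\<Sum>a\<in>B. \<Sum>b\<in>B. f a * h b * of_bool (a \<cdot> b = c))"

definition dirac :: "'b \<Rightarrow> 'b \<Rightarrow> 'k::field" where
  "dirac a = (\<lambda>c. of_bool (c = a))"

lemma carrier_semigroup_algebra: "carrier (semigroup_algebra B bmul) = vecs B"
  by (simp add: semigroup_algebra_def vecs_def Let_def)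

lemma mult_semigroup_algebra: "monoid.mult (semigroup_algebra B bmul) = conv"
proof (intro ext)
  fix f h :: "'b \<Rightarrow> 'k::field" and c
  have "(\<Sum>(a, b) \<in> {(a, b). a \<in> B \<and> b \<in> B \<and> a \<cdot> b = c}. f a * h b)
      = (\<Sum>(a, b) \<in> {p \<in> B \<times> B. fst p \<cdot> snd p = c}. f a * h b)"
    by (rule sum.cong) auto
  also have "\<dots> = (\<Sum>(a, b) \<in> B \<times> B. f a * h b * of_bool (a \<cdot> b = c))"
    using finite_carrier
    by (subst sum.inter_filter) (auto intro!: sum.cong)
  finally show "monoid.mult (semigroup_algebra B bmul) f h c = conv f h c"
    by (simp add: semigroup_algebra_def Let_def conv_def sum.cartesian_product)
qed

lemma dirac_vecs: "a \<in> S \<Longrightarrow> dirac a \<in> vecs S"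
  by (auto simp: vecs_def dirac_def)

text \<open>Evaluates the linear extension of \<open>u\<close> at a product. Indicators, possibly
  scaled, in the place of \<open>u\<close> give associativity and multiplicativity of the
  characters.\<close>

lemma sum_conv:
  "(\<Sum>c\<in>B. conv f h c * u c) = (\<Sum>a\<in>B. \<Sum>b\<in>B. f a * h b * u (a \<cdot> b))"
proof -
  have "(\<Sum>c\<in>B. conv f h c * u c)
      = (\<Sum>c\<in>B. \<Sum>a\<in>B. \<Sum>b\<in>B. f a * h b * (of_bool (a \<cdot> b = c) * u c))"
    by (simp add: conv_def sum_distrib_right mult.assoc)
  also have "\<dots> = (\<Sum>a\<in>B. \<Sum>b\<in>B. \<Sum>c\<in>B. f a * h b * (of_bool (a \<cdot> b = c) * u c))"
    by (subst sum.swap, rule sum.cong[OF refl], rule sum.swap)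
  also have "\<dots> = (\<Sum>a\<in>B. \<Sum>b\<in>B. f a * h b * u (a \<cdot> b))"
  proof (intro sum.cong refl)
    fix a b assume "a \<in> B" "b \<in> B"
    then show "(\<Sum>c\<in>B. f a * h b * (of_bool (a \<cdot> b = c) * u c)) = f a * h b * u (a \<cdot> b)"
      using sum.delta'[OF finite_carrier, of "a \<cdot> b" "\<lambda>c. f a * h b * u c"] closed[of a b]
      by (simp add: of_bool_def if_distrib[of "\<lambda>t. t * u _"] if_distrib[of "\<lambda>t. f a * h b * t"] cong: if_cong)
  qed
  finally show ?thesis .
qed

lemma sum_dirac:
  fixes u v :: "'b \<Rightarrow> 'k::field"
  assumes "a \<in> B"
  shows "(\<Sum>c\<in>B. dirac a c * u c) = u a" "(\<Sum>c\<in>B. u c * dirac a c) = u a"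
    "(\<Sum>c\<in>B. u c * dirac a c * v c) = u a * v a"
proof -
  have "(\<Sum>c\<in>B. w c * dirac a c) = w a" for w :: "'b \<Rightarrow> 'k"
  proof -
    have "(\<Sum>c\<in>B. w c * dirac a c) = (\<Sum>c\<in>B. if c = a then w c else 0)"
      by (intro sum.cong refl) (simp add: dirac_def)
    then show ?thesis using assms finite_carrier by simp
  qed
  from this[of u] this[of "\<lambda>c. u c * v c"]
  show "(\<Sum>c\<in>B. dirac a c * u c) = u a" "(\<Sum>c\<in>B. u c * dirac a c) = u a"
    "(\<Sum>c\<in>B. u c * dirac a c * v c) = u a * v a"
    by (simp_all add: mult_ac)
qed

lemma conv_dirac_left:
  assumes "a \<in> B"
  shows "conv (dirac a) h c = (\<Sum>b\<in>B. h b * of_bool (a \<cdot> b = c))"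
  using sum_dirac(1)[OF assms, of "\<lambda>a. \<Sum>b\<in>B. h b * of_bool (a \<cdot> b = c)"]
  by (simp add: conv_def sum_distrib_left mult.assoc)

lemma conv_dirac_right:
  assumes "b \<in> B"
  shows "conv f (dirac b) c = (\<Sum>a\<in>B. f a * of_bool (a \<cdot> b = c))"
  by (simp add: conv_def sum_dirac(3)[OF assms])

lemma conv_eq_sum_left: "conv f h c = (\<Sum>a\<in>B. f a * conv (dirac a) h c)"
  unfolding conv_def[of f h]
  by (intro sum.cong refl) (simp add: conv_dirac_left sum_distrib_left mult.assoc)

lemma conv_eq_sum_right: "conv f h c = (\<Sum>b\<in>B. h b * conv f (dirac b) c)"
  unfolding conv_def[of f h]
  by (subst sum.swap, intro sum.cong refl)
    (simp add: conv_dirac_right sum_distrib_left mult_ac)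

lemma conv_dirac_dirac:
  assumes "a \<in> B" "b \<in> B"
  shows "conv (dirac a) (dirac b) = dirac (a \<cdot> b)"
proof
  fix c
  show "conv (dirac a) (dirac b) c = dirac (a \<cdot> b) c"
    unfolding conv_dirac_left[OF assms(1)] sum_dirac(1)[OF assms(2)] by (auto simp: dirac_def)
qed

lemma conv_assoc: "conv (conv f g) h = conv f (conv g h)"
proof
  fix c
  have "conv (conv f g) h c = (\<Sum>b\<in>B. \<Sum>a\<in>B. conv f g a * (h b * of_bool (a \<cdot> b = c)))"
    unfolding conv_def[of "conv f g"] by (subst sum.swap) (simp add: mult.assoc)
  also have "\<dots> = (\<Sum>b\<in>B. \<Sum>x\<in>B. \<Sum>y\<in>B. f x * g y * (h b * of_bool (x \<cdot> y \<cdot> b = c)))"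
    by (simp add: sum_conv)
  also have "\<dots> = (\<Sum>x\<in>B. \<Sum>y\<in>B. \<Sum>b\<in>B. f x * g y * (h b * of_bool (x \<cdot> y \<cdot> b = c)))"
    by (subst sum.swap, rule sum.cong[OF refl], rule sum.swap)
  also have "\<dots> = (\<Sum>x\<in>B. \<Sum>y\<in>B. \<Sum>b\<in>B. g y * h b * (f x * of_bool (x \<cdot> (y \<cdot> b) = c)))"
    by (intro sum.cong refl) (simp add: assoc mult_ac)
  also have "\<dots> = conv f (conv g h) c"
    unfolding conv_def[of f "conv g h"]
  proof (rule sum.cong[OF refl])
    fix x
    show "(\<Sum>y\<in>B. \<Sum>b\<in>B. g y * h b * (f x * of_bool (x \<cdot> (y \<cdot> b) = c)))
        = (\<Sum>b\<in>B. f x * conv g h b * of_bool (x \<cdot> b = c))"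
      using sum_conv[of g h "\<lambda>b. f x * of_bool (x \<cdot> b = c)"] by (simp add: mult_ac)
  qed
  finally show "conv (conv f g) h c = conv f (conv g h) c" .
qed

lemma conv_vecs:
  assumes "f \<in> vecs S" "h \<in> vecs S" "\<And>a b. a \<in> S \<Longrightarrow> b \<in> S \<Longrightarrow> a \<cdot> b \<in> S"
  shows "conv f h \<in> vecs S"
  unfolding vecs_def conv_def
proof (intro CollectI allI impI sum.neutral ballI)
  fix c a b assume "c \<notin> S" "a \<in> B" "b \<in> B"
  then show "f a * h b * of_bool (a \<cdot> b = c) = 0"
    using assms by (cases "a \<in> S \<and> b \<in> S") (auto simp: vecs_def)
qed

lemma conv_closed: "conv f h \<in> vecs B"
  unfolding vecs_def conv_def
proof (intro CollectI allI impI sum.neutral ballI)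
  fix c a b assume "c \<notin> B" "a \<in> B" "b \<in> B"
  then show "f a * h b * of_bool (a \<cdot> b = c) = 0"
    using closed by auto
qed

lemma conv_add_left: "conv (\<lambda>b. f b + g b) h = (\<lambda>c. conv f h c + conv g h c)"
  by (rule ext) (simp add: conv_def distrib_right sum.distrib)

lemma conv_add_right: "conv h (\<lambda>b. f b + g b) = (\<lambda>c. conv h f c + conv h g c)"
  by (rule ext) (simp add: conv_def distrib_right distrib_left sum.distrib)

lemma conv_diff_left: "conv (\<lambda>b. f b - g b) h = (\<lambda>c. conv f h c - conv g h c)"
  by (rule ext) (simp add: conv_def left_diff_distrib sum_subtractf)

lemma conv_diff_right: "conv h (\<lambda>b. f b - g b) = (\<lambda>c. conv h f c - conv h g c)"
  by (rule ext) (simp add: conv_def left_diff_distrib right_diff_distrib sum_subtractf)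

lemma conv_zero: "conv (\<lambda>b. 0) h = (\<lambda>c. 0)" "conv h (\<lambda>b. 0) = (\<lambda>c. 0)"
  by (simp_all add: conv_def fun_eq_iff)

lemma conv_id_vecs:
  assumes "S \<subseteq> B" "z \<in> vecs S"
  shows "(\<And>a. a \<in> S \<Longrightarrow> conv (dirac a) e = dirac a) \<Longrightarrow> conv z e = z"
    and "(\<And>a. a \<in> S \<Longrightarrow> conv e (dirac a) = dirac a) \<Longrightarrow> conv e z = z"
proof -
  have *: "(\<Sum>b\<in>B. z b * dirac b c) = z c" for c
  proof -
    have "(\<Sum>b\<in>B. z b * dirac b c) = (\<Sum>b\<in>B. if c = b then z b else 0)"
      by (intro sum.cong refl) (simp add: dirac_def)
    then show ?thesis using assms finite_carrier by (auto simp: vecs_def)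
  qed
  show "conv z e = z" if "\<And>a. a \<in> S \<Longrightarrow> conv (dirac a) e = dirac a"
  proof
    fix c
    have "conv z e c = (\<Sum>b\<in>B. z b * dirac b c)"
      unfolding conv_eq_sum_left[of z e]
    proof (rule sum.cong[OF refl])
      show "z b * conv (dirac b) e c = z b * dirac b c" for b
        using that[of b] assms(2) by (cases "b \<in> S") (auto simp: vecs_def)
    qed
    then show "conv z e c = z c" using * by simp
  qed
  show "conv e z = z" if "\<And>a. a \<in> S \<Longrightarrow> conv e (dirac a) = dirac a"
  proof
    fix c
    have "conv e z c = (\<Sum>b\<in>B. z b * dirac b c)"
      unfolding conv_eq_sum_right[of e z]
    proof (rule sum.cong[OF refl])
      show "z b * conv e (dirac b) c = z b * dirac b c" for b
        using that[of b] assms(2) by (cases "b \<in> S") (auto simp: vecs_def)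
    qed
    then show "conv e z c = z c" using * by simp
  qed
qed

section \<open>The identity of a connected band\<close>

text \<open>The right identity is \<open>1 - \<Prod>x. (1 - x)\<close>, computed in the unital extension.\<close>

lemma right_identity_exists:
  assumes y: "y \<in> B"
  obtains f :: "'b \<Rightarrow> 'k::field"
  where "f \<in> vecs (upper y)" "\<And>b. b \<in> upper y \<Longrightarrow> conv (dirac b) f = dirac b"
proof -
  have "T \<subseteq> upper y \<Longrightarrow>
      \<exists>f :: 'b \<Rightarrow> 'k. f \<in> vecs (upper y) \<and> (\<forall>b\<in>T. conv (dirac b) f = dirac b)" if "finite T" for T
    using that
  proof (induction T rule: finite_induct)
    case empty
    have "(\<lambda>b. 0) \<in> vecs (upper y)" by (simp add: vecs_def)
    then show ?case by blast
  next
    case (insert x T)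
    then obtain f :: "'b \<Rightarrow> 'k"
      where f: "f \<in> vecs (upper y)" "\<forall>b\<in>T. conv (dirac b) f = dirac b"
      by blast
    have x: "x \<in> upper y" "x \<in> B" using insert.prems upper_subset by auto
    \<comment> \<open>Chosen so that 1 - f' = (1 - f)(1 - x), without an adjoined 1; hence b(1 - f)
      = 0 is inherited for \<open>b\<close> in \<open>T\<close>.\<close>
    define f' where "f' = (\<lambda>c. (f c + dirac x c) - conv f (dirac x) c)"
    have conv_f': "conv h f' = (\<lambda>c. (conv h f c + conv h (dirac x) c) - conv (conv h f) (dirac x) c)"
      for h
      unfolding f'_def conv_diff_right conv_add_right conv_assoc ..
    have "conv f (dirac x) \<in> vecs (upper y)"
      using f(1) x(1) y by (intro conv_vecs dirac_vecs) (auto simp: upper_closed)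
    then have "f' \<in> vecs (upper y)"
      using f(1) dirac_vecs[OF x(1)] unfolding f'_def by (auto simp: vecs_def dirac_def)
    moreover have "conv (dirac b) f' = dirac b" if "b \<in> insert x T" for b
    proof (cases "b = x")
      case True
      \<comment> \<open>x(1 - f)(1 - x) = 0 amounts to x f x = x f, which is left regularity term by
        term.\<close>
      have "conv (conv (dirac x) f) (dirac x) = conv (dirac x) f"
      proof
        fix c
        have "conv (conv (dirac x) f) (dirac x) c
            = (\<Sum>b\<in>B. conv f (dirac x) b * of_bool (x \<cdot> b = c))"
          by (simp add: conv_assoc conv_dirac_left x)
        also have "\<dots> = (\<Sum>a\<in>B. f a * of_bool (x \<cdot> (a \<cdot> x) = c))"
          by (simp add: sum_conv sum_dirac(3)[OF x(2)])
        also have "\<dots> = (\<Sum>a\<in>B. f a * of_bool (x \<cdot> a = c))"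
        proof (intro sum.cong refl)
          fix a assume "a \<in> B"
          then have "x \<cdot> (a \<cdot> x) = x \<cdot> a"
            using assoc[of x a x] left_regular[of x a] x by simp
          then show "f a * of_bool (x \<cdot> (a \<cdot> x) = c) = f a * of_bool (x \<cdot> a = c)" by simp
        qed
        also have "\<dots> = conv (dirac x) f c"
          by (simp add: conv_dirac_left x)
        finally show "conv (conv (dirac x) f) (dirac x) c = conv (dirac x) f c" .
      qed
      then show ?thesis
        using True x idem[of x] by (simp add: conv_f' conv_dirac_dirac)
    next
      case False
      then have "conv (dirac b) f = dirac b" using that f by blast
      then show ?thesis by (simp add: conv_f')
    qed
    ultimately show ?case by blast
  qed
  from this[OF finite_upper] that show thesis by blast
qed

end

context connected_left_regular_band
begin

text \<open>The appeal to \<open>connected\<close>: neighbours in the Hasse diagram are comparable,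
  so equality propagates along a path.\<close>

lemma constant_on_upper:
  assumes y: "y \<in> B"
    and step: "\<And>a c. a \<in> upper y \<Longrightarrow> c \<in> upper y \<Longrightarrow> c \<cdot> a = a \<Longrightarrow> d a = d c"
    and ab: "a \<in> upper y" "b \<in> upper y"
  shows "d a = d b"
proof -
  have up: "upper_part B bmul (support B bmul y) = upper y"
    using support_subset_iff[OF y] by (auto simp: upper_part_def upper_def)
  have "hasse_connected bmul (upper y)"
    using connected[of "support B bmul y"] y up by (simp add: support_semilattice_def)
  then have "(a, b) \<in> (cover_relation bmul (upper y) \<union> (cover_relation bmul (upper y))\<inverse>)\<^sup>*"
    using ab by (simp add: hasse_connected_def)
  then show ?thesis
  proof (induction rule: rtrancl_induct)
    case (step b c)
    then show ?case
      using assms(2)[of b c] assms(2)[of c b]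
      by (auto simp: cover_relation_def lrb_less_def lrb_le_def)
  qed simp
qed

text \<open>The induction is on the size of the upper part. With \<open>f\<close> a right identity, the defect
  \<open>d a = a - f a\<close> is annihilated by left multiplication, so by induction it is supported on the
  bottom support class, where right multiplication is trivial. Hence \<open>d\<close> is constant along
  the order, and linearity gives \<open>d = \<Sum>b. f b * d b = f - f f = 0\<close>.\<close>

lemma identity_upper:
  assumes "y \<in> B"
  shows "\<exists>e :: 'a \<Rightarrow> 'k::field. e \<in> vecs (upper y) \<and>
    (\<forall>a\<in>upper y. conv e (dirac a) = dirac a \<and> conv (dirac a) e = dirac a)"
  using assms
proof (induction "card (upper y)" arbitrary: y rule: less_induct)
  case less
  note y = \<open>y \<in> B\<close>
  have yy: "y \<in> upper y" using y by (simp add: upper_def supp_le_refl)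
  obtain f :: "'a \<Rightarrow> 'k"
    where f: "f \<in> vecs (upper y)" and fr: "\<And>b. b \<in> upper y \<Longrightarrow> conv (dirac b) f = dirac b"
    using right_identity_exists[OF y] by metis
  \<comment> \<open>Otherwise take the part of \<open>z\<close> on a maximal offending support
    class. It is still annihilated, and induction supplies an identity there, so it is zero.\<close>
  have annihilated: "z x = 0"
    if z: "z \<in> vecs (upper y)" and az: "\<And>a. a \<in> upper y \<Longrightarrow> conv (dirac a) z = (\<lambda>c. 0)"
      and x: "\<not> x \<lesssim> y" for z :: "'a \<Rightarrow> 'k" and x
  proof (rule ccontr)
    assume "z x \<noteq> 0"
    define Q where "Q = (\<lambda>x. z x \<noteq> 0 \<and> \<not> x \<lesssim> y)"
    \<comment> \<open>Least \<open>card (upper x)\<close> means maximal support among the offending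
      elements.\<close>
    obtain x where Qx: "Q x" and minx: "\<And>b. Q b \<Longrightarrow> card (upper x) \<le> card (upper b)"
      using exists_least_iff[of "\<lambda>n. \<exists>x. Q x \<and> n = card (upper x)"] \<open>z x \<noteq> 0\<close> x
      by (metis Q_def linorder_not_less)
    have xu: "x \<in> upper y" "z x \<noteq> 0" "\<not> x \<lesssim> y" using Qx z by (auto simp: Q_def vecs_def)
    then have xB: "x \<in> B" "y \<lesssim> x" by (auto simp: upper_def)
    define z' where "z' = (\<lambda>b. if b \<in> B \<and> b \<approx> x then z b else 0)"
    have z': "z' \<in> vecs (upper x)" by (auto simp: z'_def vecs_def upper_def supp_eq_def)
    have "conv (dirac a) z' c = 0" if a: "a \<in> upper x" for a c
    proof -
      have aB: "a \<in> B" "x \<lesssim> a" using a by (auto simp: upper_def)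
      have ay: "a \<in> upper y" using a upper_antimono[OF y xB] by blast
      show ?thesis
      \<comment> \<open>If \<open>c\<close> is in the class of \<open>x\<close>, then a b = c puts
        \<open>b\<close> above \<open>x\<close>, and maximality puts it in the class whenever
        \<open>z b\<close> is nonzero. Other \<open>c\<close> receive nothing, as left
        multiplication by \<open>a\<close> preserves the class.\<close>
      proof (cases "c \<approx> x")
        case True
        have "z' b * of_bool (a \<cdot> b = c) = z b * of_bool (a \<cdot> b = c)" if b: "b \<in> B" for b
        proof (cases "a \<cdot> b = c \<and> z b \<noteq> 0")
          case nz: True
          then have xb: "x \<lesssim> b"
            using True supp_le_mult_iff[of x a b] xB aB b by (auto simp: supp_eq_def)
          have "\<not> b \<lesssim> y" using xb xu xB y b supp_le_trans by blast
          then have "card (upper x) \<le> card (upper b)" using minx nz by (simp add: Q_def)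
          then have "b \<lesssim> x" using card_upper_less[OF xB(1) b xb] by linarith
          then show ?thesis using xb b by (simp add: z'_def supp_eq_def)
        qed (auto simp: z'_def)
        then have "conv (dirac a) z' c = conv (dirac a) z c"
          unfolding conv_dirac_left[OF aB(1)] by (rule sum.cong[OF refl])
        then show ?thesis using az[OF ay] by simp
      next
        case False
        have "z' b * of_bool (a \<cdot> b = c) = 0" if b: "b \<in> B" for b
        proof (cases "b \<approx> x")
          case True
          have "a \<cdot> b \<lesssim> b" "a \<cdot> b \<in> B" using aB b mult_supp_le closed by auto
          then have "a \<cdot> b \<lesssim> x" "x \<lesssim> a \<cdot> b"
            using True supp_le_trans[of "a \<cdot> b" b x] supp_le_mult_iff[of x a b] xB aB b
            by (auto simp: supp_eq_def)
          then have "a \<cdot> b \<noteq> c" using False by (auto simp: supp_eq_def)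
          then show ?thesis by simp
        qed (simp add: z'_def)
        then show ?thesis unfolding conv_dirac_left[OF aB(1)] by (rule sum.neutral[OF ballI])
      qed
    qed
    then have dz: "conv (dirac a) z' = (\<lambda>c. 0)" if "a \<in> upper x" for a
      using that by auto
    obtain e :: "'a \<Rightarrow> 'k" where e: "e \<in> vecs (upper x)"
      "\<forall>a\<in>upper x. conv e (dirac a) = dirac a \<and> conv (dirac a) e = dirac a"
      using less.hyps[OF card_upper_less[OF y xB(1) xB(2) xu(3)] xB(1)] by blast
    \<comment> \<open>\<open>e\<close> is a combination of elements of \<open>upper x\<close>, each
      of which annihilates \<open>z'\<close>.\<close>
    have "z' = conv e z'"
      using conv_id_vecs(2)[OF upper_subset z', of e] e(2) by simp
    also have "\<dots> = (\<lambda>c. 0)"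
    proof
      fix c
      show "conv e z' c = 0"
        unfolding conv_eq_sum_left[of e z']
      proof (intro sum.neutral ballI)
        show "e a * conv (dirac a) z' c = 0" for a
          using e(1) dz[of a] by (cases "a \<in> upper x") (auto simp: vecs_def)
      qed
    qed
    finally have "z' x = 0" by simp
    then show False using xu(2) xB by (simp add: z'_def supp_eq_refl)
  qed
  define d where "d = (\<lambda>a c. dirac a c - conv f (dirac a) c)"
  have d_vecs: "d a \<in> vecs (upper y)" if "a \<in> upper y" for a
    using dirac_vecs[OF that] conv_vecs[OF f dirac_vecs[OF that]] upper_closed[OF y]
    by (auto simp: d_def vecs_def)
  have d_ann: "conv (dirac b) (d a) = (\<lambda>c. 0)" if "b \<in> upper y" "a \<in> upper y" for a b
    unfolding d_def conv_diff_right conv_assoc[symmetric] using fr[OF that(1)] by simp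
  have "d a = d c" if ac: "a \<in> upper y" "c \<in> upper y" "c \<cdot> a = a" for a c
  proof -
    have B: "a \<in> B" "c \<in> B" using ac upper_subset by auto
    \<comment> \<open>From c a = a, the element a - f a factors as (c - f c) a.\<close>
    have "d a = conv (d c) (dirac a)"
      unfolding d_def conv_diff_left conv_assoc using B ac(3) by (simp add: conv_dirac_dirac)
    also have "\<dots> = d c"
    proof
      fix t
      have "conv (d c) (dirac a) t = (\<Sum>b\<in>B. if t = b then d c b else 0)"
        unfolding conv_dirac_right[OF B(1)]
      proof (rule sum.cong[OF refl])
        fix b assume "b \<in> B"
        show "d c b * of_bool (b \<cdot> a = t) = (if t = b then d c b else 0)"
        proof (cases "b \<lesssim> y")
          case True
          then have "b \<lesssim> a" using supp_le_trans[of b y a] \<open>b \<in> B\<close> y ac(1) by (auto simp: upper_def)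
          then show ?thesis by (auto simp: supp_le_def)
        next
          case False
          then have "d c b = 0" using annihilated[OF d_vecs d_ann] ac(2) by blast
          then show ?thesis by simp
        qed
      qed
      then show "conv (d c) (dirac a) t = d c t"
        using d_vecs[OF ac(2)] finite_carrier upper_subset by (auto simp: vecs_def)
    qed
    finally show ?thesis .
  qed
  then have d_const: "d a = d y" if "a \<in> upper y" for a
    using constant_on_upper[OF y, of d a y] that yy by blast
  have "d y = (\<lambda>c. 0)"
  proof
    fix c
    \<comment> \<open>Compare the coefficients of \<open>y\<close> in y f = y. As y b = y throughout
      \<open>upper y\<close>, the coefficients of \<open>f\<close> sum to 1.\<close>
    have "1 = conv (dirac y) f y" unfolding fr[OF yy] by (simp add: dirac_def)
    also have "\<dots> = (\<Sum>b\<in>B. f b * of_bool (y \<cdot> b = y))" by (simp add: conv_dirac_left y)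
    also have "\<dots> = (\<Sum>b\<in>B. f b)"
    proof (rule sum.cong[OF refl])
      show "f b * of_bool (y \<cdot> b = y) = f b" for b
        using f by (cases "b \<in> upper y") (auto simp: upper_def supp_le_def vecs_def)
    qed
    finally have "d y c = (\<Sum>b\<in>B. f b) * d y c" by simp
    also have "\<dots> = (\<Sum>b\<in>B. f b * d b c)"
      unfolding sum_distrib_right
    proof (rule sum.cong[OF refl])
      show "f b * d y c = f b * d b c" for b
        using f d_const[of b] by (cases "b \<in> upper y") (auto simp: vecs_def)
    qed
    also have "\<dots> = (\<Sum>b\<in>B. f b * dirac b c) - (\<Sum>b\<in>B. f b * conv f (dirac b) c)"
      by (simp add: d_def right_diff_distrib sum_subtractf)
    also have "(\<Sum>b\<in>B. f b * dirac b c) = (\<Sum>b\<in>B. f b * conv (dirac b) f c)"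
    proof (rule sum.cong[OF refl])
      show "f b * dirac b c = f b * conv (dirac b) f c" for b
        using f fr[of b] by (cases "b \<in> upper y") (auto simp: vecs_def)
    qed
    finally show "d y c = 0"
      by (simp add: conv_eq_sum_left[of f f, symmetric] conv_eq_sum_right[of f f, symmetric])
  qed
  then have "conv f (dirac a) = dirac a" if "a \<in> upper y" for a
    using d_const[OF that] by (auto simp: d_def fun_eq_iff)
  then show ?case using f fr by blast
qed

lemma identity_exists:
  obtains e :: "'a \<Rightarrow> 'k::field"
  where "e \<in> vecs B" "\<And>f. f \<in> vecs B \<Longrightarrow> conv e f = f \<and> conv f e = f"
proof (cases "B = {}")
  case True
  then have "vecs B = {\<lambda>b. 0 :: 'k}" by (auto simp: vecs_def)
  then show thesis using that[of "\<lambda>b. 0"] by (simp add: conv_zero)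
next
  case False
  then obtain y where y: "y \<in> B" "upper y = B" by (rule least_support)
  then obtain e :: "'a \<Rightarrow> 'k" where e: "e \<in> vecs B"
    "\<forall>a\<in>B. conv e (dirac a) = dirac a \<and> conv (dirac a) e = dirac a"
    using identity_upper[OF y(1)] by metis
  then show thesis
    using that conv_id_vecs[OF order_refl] by blast
qed

text \<open>The definite description is legitimate: two identities satisfy e = e e0 = e0.\<close>

lemma one_semigroup_algebra:
  defines "e \<equiv> (one (semigroup_algebra B bmul) :: 'a \<Rightarrow> 'k::field)"
  shows "e \<in> vecs B" "f \<in> vecs B \<Longrightarrow> conv e f = f" "f \<in> vecs B \<Longrightarrow> conv f e = f"
proof -
  let ?P = "\<lambda>e :: 'a \<Rightarrow> 'k. e \<in> vecs B \<and> (\<forall>f\<in>vecs B. conv e f = f \<and> conv f e = f)"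
  have e: "e = (THE e. ?P e)"
    unfolding e_def carrier_semigroup_algebra[symmetric] mult_semigroup_algebra[symmetric]
    by (simp add: semigroup_algebra_def Let_def)
  obtain e0 where e0: "?P e0" using identity_exists by metis
  have "?P e"
    unfolding e
  proof (rule theI[of ?P, OF e0])
    fix x assume "?P x"
    then show "x = e0" using e0 by metis
  qed
  then show "e \<in> vecs B" "f \<in> vecs B \<Longrightarrow> conv e f = f" "f \<in> vecs B \<Longrightarrow> conv f e = f"
    by auto
qed

end

section \<open>Characters and invariants\<close>

context left_regular_band
begin

text \<open>The characters of \<open>kB\<close>, indexed by representatives of the supports.\<close>

definition character :: "'b \<Rightarrow> ('b \<Rightarrow> 'k::field) \<Rightarrow> 'k" where
  "character y f = (\<Sum>b\<in>upper y. f b)"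

definition supp_class :: "'b \<Rightarrow> 'b set" where
  "supp_class x = {b \<in> B. b \<approx> x}"

lemma character_eq: "character y f = (\<Sum>b\<in>B. f b * of_bool (y \<lesssim> b))"
proof -
  have "character y f = (\<Sum>b\<in>B. if y \<lesssim> b then f b else 0)"
    unfolding character_def upper_def by (rule sum.inter_filter[OF finite_carrier])
  also have "\<dots> = (\<Sum>b\<in>B. f b * of_bool (y \<lesssim> b))"
    by (rule sum.cong) auto
  finally show ?thesis .
qed

text \<open>The indicator of the elements above \<open>y\<close> is multiplicative on
  \<open>B\<close>, by \<open>supp_le_mult_iff\<close>.\<close>

lemma character_conv:
  assumes "y \<in> B"
  shows "character y (conv f h) = character y f * character y h"
  unfolding character_eq sum_conv sum_product
  using assms by (intro sum.cong refl) (auto simp: supp_le_mult_iff)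

lemma character_add: "character y (\<lambda>b. f b + h b) = character y f + character y h"
  by (simp add: character_def sum.distrib)

lemma character_diff: "character y (\<lambda>b. f b - h b) = character y f - character y h"
  by (simp add: character_def sum_subtractf)

lemma character_scale: "character y (\<lambda>b. r * f b) = r * character y f"
  by (simp add: character_def sum_distrib_left)

lemma character_zero: "character y (\<lambda>b. 0) = 0"
  by (simp add: character_def)

text \<open>The diagonal entry of the triangular system: nothing above the class of \<open>x\<close>
  contributes, and the class contributes one value with multiplicity.\<close>

lemma character_supp_class:
  assumes x: "x \<in> B"
    and off: "\<And>b. b \<in> B \<Longrightarrow> x \<lesssim> b \<Longrightarrow> \<not> b \<lesssim> x \<Longrightarrow> f b = 0"
    and const: "\<And>b. b \<in> supp_class x \<Longrightarrow> f b = f x"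
  shows "character x f = of_nat (card (supp_class x)) * f x"
proof -
  have "character x f = (\<Sum>b\<in>supp_class x. f b)"
    unfolding character_def using off
    by (intro sum.mono_neutral_right finite_upper)
      (auto simp: upper_def supp_class_def supp_eq_def)
  also have "\<dots> = of_nat (card (supp_class x)) * f x"
    using const by simp
  finally show ?thesis .
qed

text \<open>Right multiplication by an element in the kernel of all characters strictly lowers supports,
  whence its nilpotency.\<close>

lemma conv_character_kernel:
  assumes j: "\<And>y. y \<in> B \<Longrightarrow> character y j = 0"
    and w: "\<And>b. card (upper b) < n \<Longrightarrow> w b = 0"
    and c: "card (upper c) \<le> n"
  shows "conv w j c = 0"
  unfolding conv_eq_sum_left[of w j c]
proof (intro sum.neutral ballI)
  fix a assume a: "a \<in> B"
  show "w a * conv (dirac a) j c = 0"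
  proof (cases "c = a")
    case True
    \<comment> \<open>The \<open>b\<close> with a b = a are exactly those above \<open>a\<close> in
      support.\<close>
    then have "conv (dirac a) j c = character a j"
      by (simp add: conv_dirac_left[OF a] character_eq supp_le_def)
    then show ?thesis using j[OF a] by simp
  next
    case False
    show ?thesis
    proof (cases "w a = 0")
      case wa: False
      have "j b * of_bool (a \<cdot> b = c) = 0" if b: "b \<in> B" for b
      proof -
        have "a \<cdot> b \<noteq> c"
        proof
          assume ab: "a \<cdot> b = c"
          then have cB: "c \<in> B" "c \<lesssim> a" using a b closed mult_supp_le by auto
          \<comment> \<open>\<open>w a \<noteq> 0\<close> puts \<open>a\<close> at level
            \<open>n\<close> or higher, while \<open>c\<close> is at level at most \<open>n\<close>;
            so \<open>c\<close> cannot be strictly below \<open>a\<close>.\<close>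
          have "\<not> card (upper a) < card (upper c)"
            using w[of a] wa c by linarith
          then have "a \<lesssim> c" using card_upper_less[OF cB(1) a cB(2)] by blast
          then have "a \<lesssim> b" using ab supp_le_mult_iff[of a a b] a b by simp
          then show False using False ab by (simp add: supp_le_def)
        qed
        then show ?thesis by simp
      qed
      then have "conv (dirac a) j c = 0"
        unfolding conv_dirac_left[OF a] by (rule sum.neutral[OF ballI])
      then show ?thesis by simp
    qed simp
  qed
qed

text \<open>Substituting x = j x repeatedly gives x = w x with ever more factors \<open>j\<close> in
  \<open>w\<close>, and each factor clears one more level of \<open>card (upper b)\<close>. Levels
  stop at \<open>card B\<close>.\<close>

lemma character_kernel_fixed_zero:
  assumes j: "\<And>y. y \<in> B \<Longrightarrow> character y j = 0" and x: "x = conv j x"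
  shows "x = (\<lambda>b. 0)"
proof -
  have "\<exists>w. (\<forall>b. card (upper b) < n \<longrightarrow> w b = 0) \<and> x = conv w x" for n
  proof (induction n)
    case 0
    then show ?case using x by auto
  next
    case (Suc n)
    then obtain w where w: "\<forall>b. card (upper b) < n \<longrightarrow> w b = 0" "x = conv w x"
      by blast
    have "x = conv (conv w j) x" using w(2) x conv_assoc by metis
    moreover have "\<forall>b. card (upper b) < Suc n \<longrightarrow> conv w j b = 0"
    proof (intro allI impI)
      fix b assume "card (upper b) < Suc n"
      then show "conv w j b = 0"
        using w(1) by (intro conv_character_kernel[of j n w b] j) auto
    qed
    ultimately show ?case by blast
  qed
  then obtain w where w: "\<forall>b. card (upper b) < Suc (card B) \<longrightarrow> w b = 0" "x = conv w x"
    by blast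
  have "card (upper b) < Suc (card B)" for b
    using card_mono[OF finite_carrier upper_subset] by (simp add: less_Suc_eq_le)
  then have "w = (\<lambda>b. 0)" using w(1) by auto
  then show ?thesis using w(2) by (simp add: conv_zero)
qed

end

section \<open>Invariants as functions constant on orbits\<close>

context lrb_group_action
begin

lemma group_G: "group G"
  using group_hom group_hom.axioms(1) by blast

definition inv_vecs :: "('b \<Rightarrow> 'k::field) set" where
  "inv_vecs = {f \<in> vecs B. \<forall>g\<in>carrier G. \<forall>b\<in>B. f (\<phi> g b) = f b}"

text \<open>The combinatorial form of \<open>|\<Lambda>(B)/G| = |B/G|\<close>.\<close>

definition supports_separate_orbits :: bool where
  "supports_separate_orbits \<longleftrightarrow> (\<forall>a\<in>B. \<forall>b\<in>B. a \<approx> b \<longrightarrow> b \<in> orbit G \<phi> a)"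

text \<open>The sum of all translates of \<open>a\<close> over \<open>G\<close>, with multiplicity.
  Counting group elements makes the relevant coefficients and character values subgroup
  orders.\<close>

definition orbit_sum :: "'b \<Rightarrow> 'b \<Rightarrow> 'k::field" where
  "orbit_sum a = (\<lambda>c. of_nat (card {g \<in> carrier G. \<phi> g a = c}))"

lemma act_inv:
  assumes "g \<in> carrier G" "b \<in> B"
  shows "\<phi> g (\<phi> (inv g) b) = b" "\<phi> (inv g) (\<phi> g b) = b"
proof -
  interpret group G by (rule group_G)
  have "\<phi> \<one> b = b" using id_eq_one assms by (metis restrict_apply')
  then show "\<phi> g (\<phi> (inv g) b) = b" "\<phi> (inv g) (\<phi> g b) = b"
    using composition_rule[of b g "inv g"] composition_rule[of b "inv g" g] assms by simp_all
qed

lemma act_closed: "g \<in> carrier G \<Longrightarrow> b \<in> B \<Longrightarrow> \<phi> g b \<in> B"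
  by (rule element_image[OF _ _ refl])

lemma act_supp_le:
  assumes "g \<in> carrier G" "a \<in> B" "b \<in> B"
  shows "\<phi> g a \<lesssim> \<phi> g b \<longleftrightarrow> a \<lesssim> b"
  using assms inj_prop[OF assms(1)] closed
  by (simp add: supp_le_def action_mult[symmetric] inj_on_eq_iff)

lemma act_upper:
  assumes "g \<in> carrier G" "y \<in> B"
  shows "upper (\<phi> g y) = \<phi> g ` upper y"
proof
  show "\<phi> g ` upper y \<subseteq> upper (\<phi> g y)"
    using assms act_closed act_supp_le by (auto simp: upper_def)
  show "upper (\<phi> g y) \<subseteq> \<phi> g ` upper y"
  proof
    fix b assume "b \<in> upper (\<phi> g y)"
    then have b: "b \<in> B" "\<phi> g y \<lesssim> b" by (auto simp: upper_def)
    then obtain c where "c \<in> B" "b = \<phi> g c" using surj_prop[OF assms(1)] by blast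
    then show "b \<in> \<phi> g ` upper y" using b assms act_supp_le by (auto simp: upper_def)
  qed
qed

lemma act_supp_class:
  assumes "g \<in> carrier G" "y \<in> B"
  shows "supp_class (\<phi> g y) = \<phi> g ` supp_class y"
proof
  show "\<phi> g ` supp_class y \<subseteq> supp_class (\<phi> g y)"
    using assms act_closed act_supp_le by (auto simp: supp_class_def supp_eq_def)
  show "supp_class (\<phi> g y) \<subseteq> \<phi> g ` supp_class y"
  proof
    fix b assume "b \<in> supp_class (\<phi> g y)"
    then have b: "b \<in> B" "\<phi> g y \<approx> b" by (auto simp: supp_class_def supp_eq_def)
    then obtain c where "c \<in> B" "b = \<phi> g c" using surj_prop[OF assms(1)] by blast
    then show "b \<in> \<phi> g ` supp_class y"
      using b assms act_supp_le by (auto simp: supp_class_def supp_eq_def)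
  qed
qed

lemma card_act_image:
  assumes "g \<in> carrier G" "S \<subseteq> B"
  shows "card (\<phi> g ` S) = card S"
  using inj_prop[OF assms(1)] assms(2) card_image inj_on_subset by blast

text \<open>An automorphism preserves \<open>card (upper a)\<close>, so it cannot move a support
  strictly up or down.\<close>

lemma act_supp_ge:
  assumes "g \<in> carrier G" "a \<in> B" "a \<lesssim> \<phi> g a"
  shows "\<phi> g a \<lesssim> a"
  using card_upper_less[OF assms(2) act_closed[OF assms(1,2)] assms(3)]
    act_upper[OF assms(1,2)] card_act_image[OF assms(1) upper_subset, of a] by force

lemma character_act:
  assumes "f \<in> inv_vecs" "g \<in> carrier G" "y \<in> B"
  shows "character (\<phi> g y) f = character y f"
proof -
  have "inj_on (\<phi> g) (upper y)"
    using inj_prop[OF assms(2)] upper_subset inj_on_subset by blast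
  then show ?thesis
    unfolding character_def act_upper[OF assms(2,3)] sum.reindex[OF \<open>inj_on (\<phi> g) (upper y)\<close>]
    using assms upper_subset by (intro sum.cong) (auto simp: inv_vecs_def)
qed

lemma orbit_iff: "b \<in> orbit G \<phi> a \<longleftrightarrow> (\<exists>g\<in>carrier G. b = \<phi> g a)"
  by (auto simp: orbit_def)

lemma inv_vecs_orbit:
  assumes "f \<in> inv_vecs" "a \<in> B" "b \<in> orbit G \<phi> a"
  shows "f b = f a"
  using assms by (auto simp: inv_vecs_def orbit_def)

lemma character_orbit:
  assumes "f \<in> inv_vecs" "a \<in> B" "b \<in> orbit G \<phi> a"
  shows "character b f = character a f"
  using assms character_act by (auto simp: orbit_def)

lemma inv_vecs_add: "f \<in> inv_vecs \<Longrightarrow> h \<in> inv_vecs \<Longrightarrow> (\<lambda>b. f b + h b) \<in> inv_vecs"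
  by (auto simp: inv_vecs_def vecs_def)

lemma inv_vecs_scale: "f \<in> inv_vecs \<Longrightarrow> (\<lambda>b. r * f b) \<in> inv_vecs"
  by (auto simp: inv_vecs_def vecs_def)

lemma inv_vecs_diff: "f \<in> inv_vecs \<Longrightarrow> h \<in> inv_vecs \<Longrightarrow> (\<lambda>b. f b - h b) \<in> inv_vecs"
  by (auto simp: inv_vecs_def vecs_def)

lemma inv_vecs_zero: "(\<lambda>b. 0) \<in> inv_vecs"
  by (auto simp: inv_vecs_def vecs_def)

lemma conv_act:
  assumes g: "g \<in> carrier G" and c: "c \<in> B"
  shows "conv f h (\<phi> g c) = conv (\<lambda>b. f (\<phi> g b)) (\<lambda>b. h (\<phi> g b)) c"
proof -
  have sum_act: "(\<Sum>b\<in>B. u b) = (\<Sum>b\<in>B. u (\<phi> g b))" for u :: "'b \<Rightarrow> 'k::field"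
    using sum.reindex[OF inj_prop[OF g], of u] surj_prop[OF g] by simp
  have "conv f h (\<phi> g c) = (\<Sum>a\<in>B. \<Sum>b\<in>B. f (\<phi> g a) * h b * of_bool (\<phi> g a \<cdot> b = \<phi> g c))"
    unfolding conv_def by (rule sum_act)
  also have "\<dots> = (\<Sum>a\<in>B. \<Sum>b\<in>B. f (\<phi> g a) * h (\<phi> g b) * of_bool (\<phi> g a \<cdot> \<phi> g b = \<phi> g c))"
    by (rule sum.cong[OF refl], rule sum_act)
  also have "\<dots> = conv (\<lambda>b. f (\<phi> g b)) (\<lambda>b. h (\<phi> g b)) c"
    unfolding conv_def using g c inj_prop[OF g] closed
    by (intro sum.cong refl) (simp add: action_mult[symmetric] inj_on_eq_iff)
  finally show ?thesis .
qed

lemma conv_inv_vecs: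
  assumes "f \<in> inv_vecs" "h \<in> inv_vecs"
  shows "conv f h \<in> inv_vecs"
proof -
  have "conv f h (\<phi> g c) = conv f h c" if "g \<in> carrier G" "c \<in> B" for g c
    unfolding conv_act[OF that] unfolding conv_def
    using assms that by (intro sum.cong refl) (simp add: inv_vecs_def)
  then show ?thesis using conv_closed by (auto simp: inv_vecs_def)
qed

text \<open>Since \<open>\<phi> g\<close> is a bijection of \<open>B\<close>, the extension carries
  the coefficient at \<open>b\<close> to \<open>\<phi> g b\<close>; being fixed is therefore a
  pointwise condition.\<close>

lemma carrier_invariant_algebra: "carrier (invariant_algebra B bmul G \<phi>) = inv_vecs"
proof -
  have lin: "linear_extension B (\<phi> g) f (\<phi> g b) = f b" if "g \<in> carrier G" "b \<in> B"
    for f :: "'b \<Rightarrow> 'k::field" and g b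
  proof -
    have "{c \<in> B. \<phi> g c = \<phi> g b} = {b}"
      using that inj_prop[OF that(1)] by (auto simp: inj_on_eq_iff)
    then show ?thesis by (simp add: linear_extension_def)
  qed
  have "linear_extension B (\<phi> g) f = f \<longleftrightarrow> (\<forall>b\<in>B. f (\<phi> g b) = f b)"
    if g: "g \<in> carrier G" and f: "f \<in> vecs B" for f :: "'b \<Rightarrow> 'k::field" and g
  proof
    assume "linear_extension B (\<phi> g) f = f"
    then show "\<forall>b\<in>B. f (\<phi> g b) = f b" using lin[OF g] by metis
  next
    assume r: "\<forall>b\<in>B. f (\<phi> g b) = f b"
    show "linear_extension B (\<phi> g) f = f"
    proof
      fix c
      show "linear_extension B (\<phi> g) f c = f c"
      proof (cases "c \<in> B")
        case True
        then obtain b where b: "b \<in> B" "c = \<phi> g b" using surj_prop[OF g] by blast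
        then show ?thesis using lin[OF g b(1), of f] r by simp
      next
        case False
        then have "{b \<in> B. \<phi> g b = c} = {}" using act_closed[OF g] by auto
        then have "linear_extension B (\<phi> g) f c = 0"
          unfolding linear_extension_def by (simp only: sum.empty)
        then show ?thesis using f False by (simp add: vecs_def)
      qed
    qed
  qed
  then show ?thesis
    by (auto simp: invariant_algebra_def carrier_semigroup_algebra inv_vecs_def)
qed

lemma invariant_algebra_ops:
  "monoid.mult (invariant_algebra B bmul G \<phi>) = conv"
  "one (invariant_algebra B bmul G \<phi>) = one (semigroup_algebra B bmul)"
  "ring.add (invariant_algebra B bmul G \<phi>) = (\<lambda>f h b. f b + h b)"
  "zero (invariant_algebra B bmul G \<phi>) = (\<lambda>b. 0)"
  by (simp_all add: invariant_algebra_def mult_semigroup_algebra)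
    (simp_all add: semigroup_algebra_def Let_def)

end

section \<open>Orbit sums\<close>

text \<open>Lagrange. Every use of the characteristic passes through this fact.\<close>

lemma (in group) of_nat_card_subgroup_neq_0:
  assumes "finite (carrier G)" "\<not> CHAR('k::field) dvd Coset.order G" "subgroup H G"
  shows "(of_nat (card H) :: 'k) \<noteq> 0"
proof
  assume "(of_nat (card H) :: 'k) = 0"
  then have "CHAR('k) dvd card H" by (simp add: of_nat_eq_0_iff_char_dvd)
  moreover have "card H dvd Coset.order G"
    using lagrange[OF assms(3)] by (metis dvd_triv_right)
  ultimately show False using assms(2) dvd_trans by blast
qed

context lrb_group_action
begin

lemma orbit_eqI:
  assumes "a \<in> B" "b \<in> orbit G \<phi> a"
  shows "orbit G \<phi> b = orbit G \<phi> a"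
proof -
  have sub: "orbit G \<phi> x \<subseteq> B" if "x \<in> B" for x
    using that act_closed by (auto simp: orbit_iff)
  then have "b \<in> B" using assms by blast
  moreover have "a \<in> orbit G \<phi> b" using orbit_sym assms \<open>b \<in> B\<close> by blast
  ultimately show ?thesis
    using orbit_trans assms sub by (meson subsetD subsetI subset_antisym)
qed

lemma orbit_sum_neq_0D: "orbit_sum a c \<noteq> 0 \<Longrightarrow> c \<in> orbit G \<phi> a"
proof (rule ccontr)
  assume "orbit_sum a c \<noteq> 0" "c \<notin> orbit G \<phi> a"
  then have "{g \<in> carrier G. \<phi> g a = c} = {}" by (auto simp: orbit_iff)
  then have "orbit_sum a c = 0" unfolding orbit_sum_def by (simp only: card.empty of_nat_0)
  with \<open>orbit_sum a c \<noteq> 0\<close> show False by contradiction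
qed

lemma orbit_sum_inv_vecs:
  assumes a: "a \<in> B"
  shows "orbit_sum a \<in> inv_vecs"
proof -
  interpret group G by (rule group_G)
  have "card {g \<in> carrier G. \<phi> g a = \<phi> h c} = card {g \<in> carrier G. \<phi> g a = c}"
    if h: "h \<in> carrier G" and c: "c \<in> B" for h c
  proof (rule sym, rule bij_betw_same_card)
    \<comment> \<open>Left translation by \<open>h\<close> matches the two fibres of the orbit
      map.\<close>
    show "bij_betw (\<lambda>g. h \<otimes> g) {g \<in> carrier G. \<phi> g a = c} {g \<in> carrier G. \<phi> g a = \<phi> h c}"
      using h c a by (intro bij_betwI[where g = "\<lambda>g. inv h \<otimes> g"])
        (auto simp: composition_rule act_inv m_assoc[symmetric])
  qed
  moreover have "orbit_sum a c = 0" if "c \<notin> B" for c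
    using orbit_sum_neq_0D[of a c] that a act_closed by (auto simp: orbit_iff)
  ultimately show ?thesis
    unfolding inv_vecs_def vecs_def by (auto simp: orbit_sum_def)
qed

lemma character_orbit_sum:
  assumes fin: "finite (carrier G)" and a: "a \<in> B"
  shows "character y (orbit_sum a) = of_nat (card {g \<in> carrier G. y \<lesssim> \<phi> g a})"
proof -
  let ?S = "{g \<in> carrier G. y \<lesssim> \<phi> g a}"
  have "(\<Sum>c\<in>upper y. card {g \<in> carrier G. \<phi> g a = c})
      = (\<Sum>c\<in>upper y. \<Sum>g\<in>{g \<in> ?S. \<phi> g a = c}. 1)"
    by (intro sum.cong refl) (simp, rule arg_cong[where f = card], auto simp: upper_def)
  also have "\<dots> = (\<Sum>g\<in>?S. 1)"
    using fin a act_closed by (intro sum.group finite_upper) (auto simp: upper_def)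
  finally show ?thesis
    unfolding character_def orbit_sum_def of_nat_sum[symmetric] by simp
qed

text \<open>The coefficient is the order of the stabilizer of \<open>a\<close>.\<close>

lemma orbit_sum_self_neq_0:
  assumes "finite (carrier G)" "\<not> CHAR('k::field) dvd Coset.order G" "a \<in> B"
  shows "(orbit_sum a a :: 'k) \<noteq> 0"
  using group.of_nat_card_subgroup_neq_0[OF group_G assms(1,2) stabilizer_subgroup[OF assms(3)]]
  by (simp add: orbit_sum_def stabilizer_def)

text \<open>The value counts the stabilizer of the support of \<open>a\<close>, which is a
  subgroup.\<close>

lemma character_orbit_sum_neq_0:
  assumes "finite (carrier G)" "\<not> CHAR('k::field) dvd Coset.order G" and a: "a \<in> B"
  shows "(character a (orbit_sum a) :: 'k) \<noteq> 0"
proof -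
  interpret group G by (rule group_G)
  \<comment> \<open>Closure under inverses needs the reverse comparison, provided by
    \<open>act_supp_ge\<close>.\<close>
  have inv: "a \<lesssim> \<phi> (inv g) a" if g: "g \<in> carrier G" "a \<lesssim> \<phi> g a" for g
  proof -
    have "\<phi> g a \<lesssim> \<phi> g (\<phi> (inv g) a)"
      using act_supp_ge[OF g(1) a g(2)] by (simp add: act_inv g a)
    then show ?thesis using act_supp_le g a act_closed by simp
  qed
  have "subgroup {g \<in> carrier G. a \<lesssim> \<phi> g a} G"
  proof (rule subgroupI)
    have "\<phi> \<one> a = a" using id_eq_one a by (metis restrict_apply')
    then show "{g \<in> carrier G. a \<lesssim> \<phi> g a} \<noteq> {}" using a supp_le_refl by force
  next
    fix g h assume "g \<in> {g \<in> carrier G. a \<lesssim> \<phi> g a}" "h \<in> {g \<in> carrier G. a \<lesssim> \<phi> g a}"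
    then have gh: "g \<in> carrier G" "a \<lesssim> \<phi> g a" "h \<in> carrier G" "a \<lesssim> \<phi> h a" by auto
    then have "\<phi> g a \<lesssim> \<phi> g (\<phi> h a)" using act_supp_le a act_closed by simp
    then have "a \<lesssim> \<phi> g (\<phi> h a)"
      using supp_le_trans[OF a _ _ gh(2)] gh a act_closed by simp
    then show "g \<otimes> h \<in> {g \<in> carrier G. a \<lesssim> \<phi> g a}"
      using gh a by (simp add: composition_rule)
  qed (use inv in auto)
  then show ?thesis
    unfolding character_orbit_sum[OF assms(1) a]
    by (rule of_nat_card_subgroup_neq_0[OF assms(1,2)])
qed

text \<open>The count behind the character depends on \<open>a\<close> through its support
  alone.\<close>

lemma character_orbit_sum_cong:
  assumes "finite (carrier G)" and ab: "a \<in> B" "b \<in> B" "a \<approx> b" and y: "y \<in> B"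
  shows "character y (orbit_sum a) = (character y (orbit_sum b) :: 'k::field)"
proof -
  have "y \<lesssim> \<phi> g a \<longleftrightarrow> y \<lesssim> \<phi> g b" if g: "g \<in> carrier G" for g
  proof -
    have "\<phi> g a \<lesssim> \<phi> g b" "\<phi> g b \<lesssim> \<phi> g a"
      using ab act_supp_le g by (auto simp: supp_eq_def)
    then show ?thesis
      using supp_le_trans[OF y] act_closed[OF g] ab by blast
  qed
  then have "{g \<in> carrier G. y \<lesssim> \<phi> g a} = {g \<in> carrier G. y \<lesssim> \<phi> g b}" by blast
  then show ?thesis by (simp add: character_orbit_sum assms)
qed

text \<open>If \<open>a\<close> and \<open>b\<close> have equal support but lie in different orbits, then the product of their
  orbit sums has a nonzero coefficient at \<open>a\<close> in one order and a zero coefficient in the other.\<close>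

lemma commuting_separate_orbits:
  assumes fin: "finite (carrier G)" and char: "\<not> CHAR('k::field) dvd Coset.order G"
    and comm: "\<And>f h :: 'b \<Rightarrow> 'k. f \<in> inv_vecs \<Longrightarrow> h \<in> inv_vecs \<Longrightarrow> conv f h = conv h f"
  shows supports_separate_orbits
  unfolding supports_separate_orbits_def
proof (intro ballI impI, rule ccontr)
  fix a b assume ab: "a \<in> B" "b \<in> B" "a \<approx> b" "b \<notin> orbit G \<phi> a"
  define s t where "s = (orbit_sum a :: 'b \<Rightarrow> 'k)" and "t = (orbit_sum b :: 'b \<Rightarrow> 'k)"
  \<comment> \<open>If a' b' = a with \<open>a'\<close> in the orbit of \<open>a\<close>, the
    supports of \<open>a'\<close> and \<open>a\<close> agree, so a' b' = a' and a' = a. The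
    \<open>b'\<close> with a b' = a add up to \<open>character a t\<close>.\<close>
  have "s a' * conv (dirac a') t a = (if a' = a then s a * character a t else 0)"
    if a': "a' \<in> B" for a'
  proof (cases "a' = a")
    case True
    then show ?thesis
      by (simp add: conv_dirac_left[OF ab(1)] character_eq supp_le_def)
  next
    case False
    have "conv (dirac a') t a = 0" if "s a' \<noteq> 0"
      unfolding conv_dirac_left[OF a']
    proof (intro sum.neutral ballI)
      fix b' assume b': "b' \<in> B"
      have "a' \<cdot> b' \<noteq> a"
      proof
        assume eq: "a' \<cdot> b' = a"
        then have le: "a \<lesssim> a'" "a \<lesssim> b'" using mult_supp_le[OF a' b'] by auto
        obtain g where "g \<in> carrier G" "a' = \<phi> g a"
          using orbit_sum_neq_0D \<open>s a' \<noteq> 0\<close> by (auto simp: s_def orbit_iff)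
        then have "a' \<lesssim> a" using act_supp_ge le ab(1) by blast
        then have "a' \<lesssim> b'" using supp_le_trans[OF a' ab(1) b'] le by blast
        then show False using eq False by (simp add: supp_le_def)
      qed
      then show "t b' * of_bool (a' \<cdot> b' = a) = 0" by simp
    qed
    then show ?thesis using False by auto
  qed
  then have "conv s t a = (\<Sum>a'\<in>B. if a' = a then s a * character a t else 0)"
    unfolding conv_eq_sum_left[of s t a] by (rule sum.cong[OF refl])
  then have "conv s t a = s a * character a t"
    using finite_carrier ab(1) by simp
  moreover have "s a \<noteq> 0" using orbit_sum_self_neq_0[OF fin char ab(1)] by (simp add: s_def)
  \<comment> \<open>Equal supports give \<open>t\<close> the same character value as
    \<open>s\<close>.\<close>
  moreover have "character a t \<noteq> 0"
    using character_orbit_sum_neq_0[OF fin char ab(1)]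
      character_orbit_sum_cong[OF fin ab(1,2,3,1), where 'k = 'k] by (simp add: t_def)
  \<comment> \<open>In this order b' a' = a would force b' = a, placing \<open>a\<close> in the
    orbit of \<open>b\<close>.\<close>
  moreover have "conv t s a = 0"
    unfolding conv_def
  proof (intro sum.neutral ballI)
    fix b' a' assume B: "b' \<in> B" "a' \<in> B"
    show "t b' * s a' * of_bool (b' \<cdot> a' = a) = 0"
    proof (rule ccontr)
      assume "t b' * s a' * of_bool (b' \<cdot> a' = a) \<noteq> 0"
      then have eq: "b' \<cdot> a' = a" and "t b' \<noteq> 0" by auto
      then obtain g where g: "g \<in> carrier G" "b' = \<phi> g b"
        using orbit_sum_neq_0D by (auto simp: t_def orbit_iff)
      have le: "a \<lesssim> b'" "a \<lesssim> a'" using eq mult_supp_le[OF B] by auto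
      then have "b \<lesssim> b'" using supp_le_trans[OF ab(2,1) B(1)] ab(3) by (simp add: supp_eq_def)
      then have "b' \<lesssim> b" using act_supp_ge g ab(2) by blast
      then have "b' \<lesssim> a'"
        using supp_le_trans[OF B(1) ab(2,1)] supp_le_trans[OF B(1) ab(1) B(2)] le ab(3)
        by (simp add: supp_eq_def)
      then have "a = \<phi> g b" using eq g by (simp add: supp_le_def)
      then have "a \<in> orbit G \<phi> b" using g by (auto simp: orbit_iff)
      then show False using ab orbit_sym by blast
    qed
  qed
  moreover have "conv s t = conv t s"
    unfolding s_def t_def by (intro comm orbit_sum_inv_vecs ab(1,2))
  ultimately show False by simp
qed

text \<open>Evaluating \<open>character x\<close> at the orbit sum in two ways gives the class size
  times the stabilizer order on one side and a nonzero value on the other.\<close>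

lemma of_nat_card_supp_class_neq_0:
  assumes "finite (carrier G)" "\<not> CHAR('k::field) dvd Coset.order G"
    and sep: supports_separate_orbits and x: "x \<in> B"
  shows "(of_nat (card (supp_class x)) :: 'k) \<noteq> 0"
proof -
  have "character x (orbit_sum x) = of_nat (card (supp_class x)) * (orbit_sum x x :: 'k)"
  proof (rule character_supp_class[OF x])
    fix b assume "b \<in> B" "x \<lesssim> b" "\<not> b \<lesssim> x"
    then show "orbit_sum x b = (0 :: 'k)"
      using orbit_sum_neq_0D[of x b] act_supp_ge x by (auto simp: orbit_iff)
  next
    fix b assume "b \<in> supp_class x"
    then have "b \<in> orbit G \<phi> x"
      using sep x supp_eq_sym by (auto simp: supports_separate_orbits_def supp_class_def)
    then show "orbit_sum x b = (orbit_sum x x :: 'k)"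
      by (rule inv_vecs_orbit[OF orbit_sum_inv_vecs[OF x] x])
  qed
  then show ?thesis using character_orbit_sum_neq_0[OF assms(1,2) x] by auto
qed

text \<open>Solves the triangular system for the difference, from maximal supports downwards;
  separation makes the difference constant on each support class.\<close>

lemma characters_separate:
  assumes fin: "finite (carrier G)" and char: "\<not> CHAR('k::field) dvd Coset.order G"
    and sep: supports_separate_orbits
    and fh: "f \<in> inv_vecs" "h \<in> inv_vecs"
    and eq: "\<And>y. y \<in> B \<Longrightarrow> character y f = character y (h :: 'b \<Rightarrow> 'k)"
  shows "f = h"
proof -
  define z where "z = (\<lambda>b. f b - h b)"
  have z: "z \<in> inv_vecs" using fh by (simp add: z_def inv_vecs_diff)
  have zB: "b \<in> B" if "z b \<noteq> 0" for b using that z by (auto simp: inv_vecs_def vecs_def)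
  have "z x = 0" for x
  proof (induction "card (upper x)" arbitrary: x rule: less_induct)
    case less
    show ?case
    proof (cases "x \<in> B")
      case x: True
      have "character x z = of_nat (card (supp_class x)) * z x"
      proof (rule character_supp_class[OF x])
        fix b assume "b \<in> B" "x \<lesssim> b" "\<not> b \<lesssim> x"
        then show "z b = 0" using less card_upper_less x by blast
      next
        fix b assume "b \<in> supp_class x"
        then have "b \<in> orbit G \<phi> x"
          using sep x supp_eq_sym by (auto simp: supports_separate_orbits_def supp_class_def)
        then show "z b = z x" using inv_vecs_orbit[OF z x] by simp
      qed
      moreover have "character x z = 0" using eq[OF x] by (simp add: z_def character_diff)
      ultimately show ?thesis
        using of_nat_card_supp_class_neq_0[OF fin char sep x] by auto
    qed (use zB in blast)
  qed
  then show ?thesis by (auto simp: z_def)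
qed

text \<open>The same system solved for prescribed values, one level of \<open>card (upper y)\<close>
  at a time.\<close>

lemma characters_interpolate:
  assumes fin: "finite (carrier G)" and char: "\<not> CHAR('k::field) dvd Coset.order G"
    and sep: supports_separate_orbits
    and v: "\<And>g y. g \<in> carrier G \<Longrightarrow> y \<in> B \<Longrightarrow> v (\<phi> g y) = (v y :: 'k)"
  obtains z where "z \<in> inv_vecs" "\<And>y. y \<in> B \<Longrightarrow> character y z = v y"
proof -
  have "\<exists>z \<in> inv_vecs. \<forall>y\<in>B. card (upper y) < n \<longrightarrow> character y z = v y" for n
  proof (induction n)
    case 0
    then show ?case using inv_vecs_zero by auto
  next
    case (Suc n)
    then obtain z where z: "z \<in> inv_vecs"
      "\<forall>y\<in>B. card (upper y) < n \<longrightarrow> character y z = v y" by blast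
    \<comment> \<open>The remaining error at level \<open>n\<close>, divided by the diagonal entry.
      Characters of smaller upper parts do not see level \<open>n\<close>, so earlier values
      survive.\<close>
    define w where "w = (\<lambda>b. if b \<in> B \<and> card (upper b) = n
      then (v b - character b z) / of_nat (card (supp_class b)) else 0)"
    have "w (\<phi> g b) = w b" if "g \<in> carrier G" "b \<in> B" for g b
    proof -
      have "supp_class b \<subseteq> B" by (auto simp: supp_class_def)
      then show ?thesis
        using that v character_act[OF z(1) that] act_upper[OF that] act_supp_class[OF that]
          card_act_image[OF that(1) upper_subset, of b] card_act_image[OF that(1), of "supp_class b"]
          act_closed[OF that]
        by (simp add: w_def)
    qed
    then have w: "w \<in> inv_vecs" by (auto simp: inv_vecs_def vecs_def w_def)
    have "character y (\<lambda>b. z b + w b) = v y" if y: "y \<in> B" and le: "card (upper y) < Suc n" for y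
    proof (cases "card (upper y) = n")
      case False
      have "character y w = 0"
        unfolding character_def
      proof (intro sum.neutral ballI)
        fix b assume "b \<in> upper y"
        then have "card (upper b) \<le> card (upper y)" using card_upper_mono y by (simp add: upper_def)
        then show "w b = 0" using False le by (simp add: w_def)
      qed
      then show ?thesis using False le z(2) y by (simp add: character_add)
    next
      case True
      have "character y w = of_nat (card (supp_class y)) * w y"
      proof (rule character_supp_class[OF y])
        fix b assume "b \<in> B" "y \<lesssim> b" "\<not> b \<lesssim> y"
        then show "w b = 0" using card_upper_less[OF y, of b] True by (simp add: w_def)
      next
        fix b assume "b \<in> supp_class y"
        then have "b \<in> orbit G \<phi> y"
          using sep y supp_eq_sym by (auto simp: supports_separate_orbits_def supp_class_def)
        then show "w b = w y" using inv_vecs_orbit[OF w y] by simp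
      qed
      also have "\<dots> = v y - character y z"
        using of_nat_card_supp_class_neq_0[OF fin char sep y] y True by (simp add: w_def)
      finally show ?thesis by (simp add: character_add)
    qed
    then show ?case using inv_vecs_add[OF z(1) w] by blast
  qed
  then obtain z where z: "z \<in> inv_vecs"
    "\<forall>y\<in>B. card (upper y) < Suc (card B) \<longrightarrow> character y z = v y" by blast
  have "card (upper b) < Suc (card B)" for b
    using card_mono[OF finite_carrier upper_subset] by (simp add: less_Suc_eq_le)
  then show thesis using that z by blast
qed

text \<open>Taking supports maps the orbits of \<open>B\<close> onto those of the semilattice;
  between finite sets, equal cardinality means injectivity.\<close>

lemma card_orbits_eq_iff:
  "card (orbits G (support_semilattice B bmul) (support_action B bmul \<phi>)) = card (orbits G B \<phi>)
    \<longleftrightarrow> supports_separate_orbits"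
proof -
  let ?F = "image (support B bmul)"
  have F: "orbit G (support_action B bmul \<phi>) (support B bmul b) = ?F (orbit G \<phi> b)"
    if "b \<in> B" for b
  proof -
    have "support_action B bmul \<phi> g (support B bmul b) = support B bmul (\<phi> g b)"
      if "g \<in> carrier G" for g
      by (rule support_action_support[OF that \<open>b \<in> B\<close>])
    then show ?thesis by (auto simp: orbit_def)
  qed
  then have "orbits G (support_semilattice B bmul) (support_action B bmul \<phi>) = ?F ` orbits G B \<phi>"
    unfolding orbits_def support_semilattice_def Setcompr_eq_image image_image
    by (intro image_cong refl)
  moreover have "finite (orbits G B \<phi>)"
    using finite_carrier by (simp add: orbits_def Setcompr_eq_image)
  ultimately have "card (orbits G (support_semilattice B bmul) (support_action B bmul \<phi>))
      = card (orbits G B \<phi>) \<longleftrightarrow> inj_on ?F (orbits G B \<phi>)"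
    using card_image eq_card_imp_inj_on by metis
  also have "\<dots> \<longleftrightarrow> supports_separate_orbits"
  proof
    assume inj: "inj_on ?F (orbits G B \<phi>)"
    show supports_separate_orbits
      unfolding supports_separate_orbits_def
    proof (intro ballI impI)
      fix a b assume ab: "a \<in> B" "b \<in> B" "a \<approx> b"
      then have "?F (orbit G \<phi> a) = ?F (orbit G \<phi> b)"
        using F support_eq_iff by metis
      then have "orbit G \<phi> a = orbit G \<phi> b"
        using inj_onD[OF inj] ab(1,2) by (simp add: orbits_def) metis
      then show "b \<in> orbit G \<phi> a" using orbit_refl ab by blast
    qed
  next
    assume sep: supports_separate_orbits
    show "inj_on ?F (orbits G B \<phi>)"
    proof (rule inj_onI)
      fix X Y assume "X \<in> orbits G B \<phi>" "Y \<in> orbits G B \<phi>" and eq: "?F X = ?F Y"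
      then obtain a b where ab: "a \<in> B" "b \<in> B" and XY: "X = orbit G \<phi> a" "Y = orbit G \<phi> b"
        by (auto simp: orbits_def)
      have "support B bmul a \<in> ?F Y" using eq XY orbit_refl[OF ab(1)] by blast
      then obtain c where c: "c \<in> orbit G \<phi> b" "support B bmul a = support B bmul c"
        using XY by blast
      then have cB: "c \<in> B" using ab act_closed by (auto simp: orbit_iff)
      then have "c \<in> orbit G \<phi> a"
        using sep c ab support_eq_iff by (auto simp: supports_separate_orbits_def)
      then show "X = Y"
        unfolding XY using c(1) ab cB orbit_eqI by metis
    qed
  qed
  finally show ?thesis .
qed

end

section \<open>Semisimplicity\<close>

text \<open>For \<open>x\<close> in a simple left ideal \<open>L\<close>, the left ideal \<open>J x\<close> is \<open>0\<close> or \<open>L\<close>; the latter would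
  give \<open>x = j x\<close> for some \<open>j \<in> J\<close>.\<close>

lemma semisimple_nil_left_ideal:
  fixes R (structure)
  assumes ss: "semisimple_ring R" and J: "left_ideal J R"
    and nil: "\<And>j x. j \<in> J \<Longrightarrow> x \<in> carrier R \<Longrightarrow> x = j \<otimes> x \<Longrightarrow> x = \<zero>"
  shows "J = {\<zero>}"
proof -
  interpret ring R using ss by (simp add: semisimple_ring_def)
  interpret J: additive_subgroup J R using J by (simp add: left_ideal_def)
  have Jsub: "j \<in> carrier R" if "j \<in> J" for j using that J.a_subset by blast
  obtain \<L> where \<L>: "finite \<L>" "\<And>L. L \<in> \<L> \<Longrightarrow> simple_left_ideal L R"
    and dec: "\<And>x. x \<in> carrier R \<Longrightarrow> \<exists>!y. y \<in> (\<Pi>\<^sub>E L\<in>\<L>. L) \<and> x = finsum R y \<L>"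
    using ss by (auto simp: semisimple_ring_def)
  obtain y where y: "y \<in> (\<Pi>\<^sub>E L\<in>\<L>. L)" "\<one> = finsum R y \<L>"
    using dec[of \<one>] by auto
  \<comment> \<open>Once \<open>j\<close> annihilates every component of 1, it annihilates 1 and
    vanishes.\<close>
  have ann: "j \<otimes> y L = \<zero>" if j: "j \<in> J" and L: "L \<in> \<L>" for j L
  proof -
    have sL: "left_ideal L R" "\<And>I. left_ideal I R \<Longrightarrow> I \<subseteq> L \<Longrightarrow> I = {\<zero>} \<or> I = L"
      using \<L>(2)[OF L] by (auto simp: simple_left_ideal_def)
    interpret L: additive_subgroup L R using sL(1) by (simp add: left_ideal_def)
    have x: "y L \<in> L" "y L \<in> carrier R" using y(1) L L.a_subset by auto
    define I where "I = (\<lambda>j. j \<otimes> y L) ` J"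
    have "left_ideal I R"
      unfolding left_ideal_def
    proof (intro conjI ballI)
      have "subgroup I (add_monoid R)"
      proof (rule add.subgroupI)
        show "I \<subseteq> carrier R" using Jsub x by (auto simp: I_def)
        show "I \<noteq> {}" unfolding I_def using J.zero_closed by blast
        fix a assume "a \<in> I"
        then obtain k where k: "k \<in> J" "a = k \<otimes> y L" by (auto simp: I_def)
        then have "\<ominus> a = (\<ominus> k) \<otimes> y L" using Jsub x by (simp add: l_minus)
        then show "\<ominus> a \<in> I" using k J.a_inv_closed by (auto simp: I_def)
        fix b assume "b \<in> I"
        then obtain l where l: "l \<in> J" "b = l \<otimes> y L" by (auto simp: I_def)
        then have "a \<oplus> b = (k \<oplus> l) \<otimes> y L" using k Jsub x by (simp add: l_distr)
        then show "a \<oplus> b \<in> I" using k l J.a_closed by (auto simp: I_def)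
      qed
      then show "additive_subgroup I R" by (rule additive_subgroupI)
    next
      fix r a assume r: "r \<in> carrier R" and "a \<in> I"
      then obtain k where k: "k \<in> J" "a = k \<otimes> y L" by (auto simp: I_def)
      then have "r \<otimes> a = (r \<otimes> k) \<otimes> y L" using r Jsub x by (simp add: m_assoc)
      moreover have "r \<otimes> k \<in> J" using J k r by (simp add: left_ideal_def)
      ultimately show "r \<otimes> a \<in> I" by (auto simp: I_def)
    qed
    moreover have "I \<subseteq> L" using sL(1) x Jsub by (auto simp: I_def left_ideal_def)
    ultimately consider "I = {\<zero>}" | "I = L" using sL(2) by blast
    then show ?thesis
    proof cases
      case 1
      then show ?thesis using j by (auto simp: I_def)
    next
      case 2
      then obtain k where "k \<in> J" "y L = k \<otimes> y L" using x by (auto simp: I_def)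
      then have "y L = \<zero>" using nil x by blast
      then show ?thesis using j Jsub by simp
    qed
  qed
  have "j = \<zero>" if j: "j \<in> J" for j
  proof -
    have ycl: "y \<in> \<L> \<rightarrow> carrier R"
    proof
      fix L assume L: "L \<in> \<L>"
      interpret L: additive_subgroup L R
        using \<L>(2)[OF L] by (simp add: simple_left_ideal_def left_ideal_def)
      show "y L \<in> carrier R" using y(1) L L.a_subset by auto
    qed
    have "j = j \<otimes> finsum R y \<L>" using y(2) j Jsub by (simp flip: y(2))
    also have "\<dots> = (\<Oplus>L\<in>\<L>. j \<otimes> y L)" using j Jsub \<L>(1) ycl by (simp add: finsum_rdistr)
    also have "\<dots> = \<zero>"
      by (rule add.finprod_one_eqI) (use ann j in auto)
    finally show ?thesis .
  qed
  then show ?thesis using J.zero_closed by blast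
qed

section \<open>Commutativity and semisimplicity against separation of orbits\<close>

context lrb_group_action
begin

abbreviation invariant_ring :: "('b \<Rightarrow> 'k::field) ring" where
  "invariant_ring \<equiv> invariant_algebra B bmul G \<phi>"

lemma commutative_invariant_ring_iff:
  "commutative_ring (invariant_ring :: ('b \<Rightarrow> 'k::field) ring)
    \<longleftrightarrow> (\<forall>f\<in>inv_vecs. \<forall>h\<in>inv_vecs. conv f h = conv h (f :: 'b \<Rightarrow> 'k))"
  by (simp add: commutative_ring_def carrier_invariant_algebra invariant_algebra_ops)

text \<open>The two products have the same characters because the field is commutative.\<close>

lemma separate_orbits_commuting:
  assumes "finite (carrier G)" "\<not> CHAR('k::field) dvd Coset.order G" supports_separate_orbits
    and "f \<in> inv_vecs" "h \<in> inv_vecs"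
  shows "conv f h = conv h (f :: 'b \<Rightarrow> 'k)"
  using assms(4,5)
  by (intro characters_separate[OF assms(1-3)] conv_inv_vecs) (simp_all add: character_conv)

lemma additive_subgroup_invariant_ring:
  assumes R: "ring (invariant_ring :: ('b \<Rightarrow> 'k::field) ring)"
    and I: "I \<subseteq> inv_vecs" "(\<lambda>b. 0) \<in> I"
    and add: "\<And>f h. f \<in> I \<Longrightarrow> h \<in> I \<Longrightarrow> (\<lambda>b. f b + h b) \<in> I"
    and scale: "\<And>r f. f \<in> I \<Longrightarrow> (\<lambda>b. r * f b) \<in> I"
  shows "additive_subgroup I (invariant_ring :: ('b \<Rightarrow> 'k) ring)"
proof -
  interpret ring "invariant_ring :: ('b \<Rightarrow> 'k) ring" by (rule R)
  have "\<ominus>\<^bsub>invariant_ring\<^esub> f = (\<lambda>b. - 1 * f b)" if "f \<in> I" for f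
    using that I(1) inv_vecs_scale[of f "- 1"]
    by (intro minus_equality) (auto simp: carrier_invariant_algebra invariant_algebra_ops)
  then have "\<ominus>\<^bsub>invariant_ring\<^esub> f \<in> I" if "f \<in> I" for f
    using scale[OF that, of "- 1"] that by simp
  then have "subgroup I (add_monoid (invariant_ring :: ('b \<Rightarrow> 'k) ring))"
    using I add
    by (intro add.subgroupI) (auto simp: carrier_invariant_algebra invariant_algebra_ops)
  then show ?thesis by (rule additive_subgroupI)
qed

text \<open>Semisimplicity annihilates the common kernel \<open>J\<close> of the characters, while
  two orbits with one support would leave a nonzero element in it.\<close>

lemma semisimple_separate_orbits:
  assumes fin: "finite (carrier G)" and char: "\<not> CHAR('k::field) dvd Coset.order G"
    and ss: "semisimple_ring (invariant_ring :: ('b \<Rightarrow> 'k) ring)"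
  shows supports_separate_orbits
  unfolding supports_separate_orbits_def
proof (intro ballI impI, rule ccontr)
  fix a b assume ab: "a \<in> B" "b \<in> B" "a \<approx> b" "b \<notin> orbit G \<phi> a"
  have R: "ring (invariant_ring :: ('b \<Rightarrow> 'k) ring)" using ss by (simp add: semisimple_ring_def)
  define J where "J = {f \<in> inv_vecs. \<forall>y\<in>B. character y f = (0 :: 'k)}"
  have "left_ideal J invariant_ring"
    unfolding left_ideal_def
  proof (intro conjI ballI additive_subgroup_invariant_ring R)
    fix r j :: "'b \<Rightarrow> 'k" assume "r \<in> carrier invariant_ring" "j \<in> J"
    then show "r \<otimes>\<^bsub>invariant_ring\<^esub> j \<in> J"
      by (simp add: J_def conv_inv_vecs character_conv carrier_invariant_algebra
          invariant_algebra_ops)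
  qed (auto simp: J_def inv_vecs_zero inv_vecs_add inv_vecs_scale character_zero character_add
      character_scale)
  moreover have "x = \<zero>\<^bsub>invariant_ring\<^esub>"
    if "j \<in> J" "x = j \<otimes>\<^bsub>invariant_ring\<^esub> x" for j x
    using that character_kernel_fixed_zero[of j x] by (simp add: J_def invariant_algebra_ops)
  ultimately have J0: "J = {\<zero>\<^bsub>invariant_ring\<^esub>}"
    by (intro semisimple_nil_left_ideal[OF ss]) auto
  have "(\<lambda>c. orbit_sum a c - orbit_sum b c) \<in> J"
    using ab character_orbit_sum_cong[OF fin ab(1-3), where 'k = 'k]
    by (simp add: J_def inv_vecs_diff orbit_sum_inv_vecs character_diff)
  then have "(\<lambda>c. orbit_sum a c - orbit_sum b c) = (\<lambda>c. 0 :: 'k)"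
    unfolding J0 invariant_algebra_ops by (rule singletonD)
  \<comment> \<open>Evaluation at \<open>a\<close> isolates a stabilizer order, since
    \<open>a\<close> is outside the orbit of \<open>b\<close>.\<close>
  then have "orbit_sum a a - orbit_sum b a = (0 :: 'k)" by (rule fun_cong)
  moreover have "orbit_sum b a = (0 :: 'k)"
    using orbit_sum_neq_0D[of b a] orbit_sym ab by blast
  ultimately show False using orbit_sum_self_neq_0[OF fin char ab(1)] by simp
qed

section \<open>Decomposition of the invariant ring into orbit ideals\<close>

lemma finsum_invariant_ring:
  assumes R: "ring (invariant_ring :: ('b \<Rightarrow> 'k::field) ring)"
    and "finite S" "\<And>i. i \<in> S \<Longrightarrow> y i \<in> inv_vecs"
  shows "finsum (invariant_ring :: ('b \<Rightarrow> 'k) ring) y S = (\<lambda>b. \<Sum>i\<in>S. y i b)"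
proof -
  interpret ring "invariant_ring :: ('b \<Rightarrow> 'k) ring" by (rule R)
  show ?thesis
    using assms(2,3)
  proof (induction S rule: finite_induct)
    case empty
    then show ?case by (simp add: invariant_algebra_ops)
  next
    case (insert i S)
    then show ?case
      by (simp add: Pi_def carrier_invariant_algebra invariant_algebra_ops(3))
  qed
qed

text \<open>When supports separate orbits, this is the factor of the product of copies of the field
  that belongs to the orbit of \<open>b\<close>.\<close>

definition orbit_ideal :: "'b \<Rightarrow> ('b \<Rightarrow> 'k::field) set" where
  "orbit_ideal b = {z \<in> inv_vecs. \<forall>y\<in>B. y \<notin> orbit G \<phi> b \<longrightarrow> character y z = 0}"

lemma orbit_ideal_component:
  assumes fin: "finite (carrier G)" and char: "\<not> CHAR('k::field) dvd Coset.order G"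
    and sep: supports_separate_orbits and b: "b \<in> B"
  obtains w :: "'b \<Rightarrow> 'k::field" where "w \<in> orbit_ideal b" "character b w = c"
proof -
  have "\<phi> g y \<in> orbit G \<phi> b \<longleftrightarrow> y \<in> orbit G \<phi> b" if "g \<in> carrier G" "y \<in> B" for g y
  proof -
    have "\<phi> g y \<in> orbit G \<phi> y" using that by (auto simp: orbit_iff)
    then show ?thesis
      using orbit_eqI[OF that(2)] orbit_eqI[OF b] orbit_refl that act_closed by metis
  qed
  then obtain w where "w \<in> inv_vecs"
    "\<And>y. y \<in> B \<Longrightarrow> character y w = (if y \<in> orbit G \<phi> b then c else 0)"
    using characters_interpolate[OF fin char sep, of "\<lambda>y. if y \<in> orbit G \<phi> b then c else 0"]
    by metis
  then show thesis using b orbit_refl by (intro that[of w]) (auto simp: orbit_ideal_def)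
qed

lemma orbit_ideal_eqI:
  assumes fin: "finite (carrier G)" and char: "\<not> CHAR('k::field) dvd Coset.order G"
    and sep: supports_separate_orbits and b: "b \<in> B"
    and "w \<in> orbit_ideal b" "w' \<in> orbit_ideal b" "character b w = character b (w' :: 'b \<Rightarrow> 'k)"
  shows "w = w'"
proof (rule characters_separate[OF fin char sep])
  fix y assume "y \<in> B"
  then show "character y w = character y w'"
    using assms(5-7) character_orbit[of w b y] character_orbit[of w' b y] b
    by (cases "y \<in> orbit G \<phi> b") (auto simp: orbit_ideal_def)
qed (use assms in \<open>auto simp: orbit_ideal_def\<close>)

text \<open>The decomposition is indexed by the ideals as sets, so coincidences among them must be
  known. An element with character 1 at \<open>b\<close> tells different orbits apart.\<close>

lemma orbit_ideal_eq_iff: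
  assumes fin: "finite (carrier G)" and char: "\<not> CHAR('k::field) dvd Coset.order G"
    and sep: supports_separate_orbits and bc: "b \<in> B" "c \<in> B"
  shows "(orbit_ideal b :: ('b \<Rightarrow> 'k) set) = orbit_ideal c \<longleftrightarrow> b \<in> orbit G \<phi> c"
proof
  assume eq: "(orbit_ideal b :: ('b \<Rightarrow> 'k) set) = orbit_ideal c"
  obtain w :: "'b \<Rightarrow> 'k" where "w \<in> orbit_ideal b" "character b w = 1"
    using orbit_ideal_component[OF fin char sep bc(1)] by metis
  then have "w \<in> orbit_ideal c" "character b w \<noteq> 0" using eq by auto
  then show "b \<in> orbit G \<phi> c" using bc(1) unfolding orbit_ideal_def by blast
next
  assume "b \<in> orbit G \<phi> c"
  then show "(orbit_ideal b :: ('b \<Rightarrow> 'k) set) = orbit_ideal c"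
    using orbit_eqI[OF bc(2)] by (simp add: orbit_ideal_def)
qed

lemma simple_orbit_ideal:
  assumes fin: "finite (carrier G)" and char: "\<not> CHAR('k::field) dvd Coset.order G"
    and sep: supports_separate_orbits and b: "b \<in> B"
    and R: "ring (invariant_ring :: ('b \<Rightarrow> 'k) ring)"
  shows "simple_left_ideal (orbit_ideal b) (invariant_ring :: ('b \<Rightarrow> 'k) ring)"
  unfolding simple_left_ideal_def
proof (intro conjI allI impI)
  show "left_ideal (orbit_ideal b) (invariant_ring :: ('b \<Rightarrow> 'k) ring)"
    unfolding left_ideal_def
  proof (intro conjI ballI additive_subgroup_invariant_ring R)
    fix r j :: "'b \<Rightarrow> 'k" assume "r \<in> carrier invariant_ring" "j \<in> orbit_ideal b"
    then show "r \<otimes>\<^bsub>invariant_ring\<^esub> j \<in> orbit_ideal b"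
      by (simp add: orbit_ideal_def conv_inv_vecs character_conv carrier_invariant_algebra
          invariant_algebra_ops)
  qed (auto simp: orbit_ideal_def inv_vecs_zero inv_vecs_add inv_vecs_scale character_zero
      character_add character_scale)
  obtain w :: "'b \<Rightarrow> 'k" where w: "w \<in> orbit_ideal b" "character b w = 1"
    using orbit_ideal_component[OF fin char sep b] by metis
  moreover have "character b (\<lambda>b. 0 :: 'k) = 0" by (rule character_zero)
  ultimately have "w \<noteq> (\<lambda>b. 0)" by force
  then show "(orbit_ideal b :: ('b \<Rightarrow> 'k) set) \<noteq> {\<zero>\<^bsub>invariant_ring\<^esub>}"
    using w(1) by (auto simp: invariant_algebra_ops)
  fix J :: "('b \<Rightarrow> 'k) set"
  assume J: "left_ideal J invariant_ring" "J \<subseteq> orbit_ideal b"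
  interpret J: additive_subgroup J "invariant_ring :: ('b \<Rightarrow> 'k) ring"
    using J(1) by (simp add: left_ideal_def)
  have J0: "(\<lambda>b. 0) \<in> J" using J.zero_closed by (simp add: invariant_algebra_ops)
  show "J = {\<zero>\<^bsub>invariant_ring\<^esub>} \<or> J = orbit_ideal b"
  proof (cases "J \<subseteq> {\<lambda>b. 0}")
    case True
    then show ?thesis using J0 by (auto simp: invariant_algebra_ops)
  next
    case False
    then obtain z where z: "z \<in> J" "z \<noteq> (\<lambda>b. 0)" by blast
    then have zb: "z \<in> orbit_ideal b" using J by blast
    have zero: "(\<lambda>b. 0 :: 'k) \<in> orbit_ideal b" by (rule subsetD[OF J(2) J0])
    have c: "character b z \<noteq> 0"
    proof
      assume "character b z = 0"
      then have "z = (\<lambda>b. 0)"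
        by (intro orbit_ideal_eqI[OF fin char sep b zb zero]) (simp add: character_zero)
      then show False using z(2) by contradiction
    qed
    have "w \<in> J" if w: "w \<in> orbit_ideal b" for w
    proof -
      \<comment> \<open>Scaling \<open>w\<close> by the inverse of the character of \<open>z\<close>
        makes r z and \<open>w\<close> agree at \<open>character b\<close>.\<close>
      define r where "r = (\<lambda>x. (1 / character b z) * w x)"
      have r: "r \<in> inv_vecs" using w unfolding r_def orbit_ideal_def by (simp add: inv_vecs_scale del: times_divide_eq_left)
      then have rz: "conv r z \<in> J"
        using J(1) z(1) by (simp add: left_ideal_def carrier_invariant_algebra invariant_algebra_ops)
      have "character b (conv r z) = character b w"
        using c b unfolding r_def character_conv[OF b] character_scale by simp
      then have "conv r z = w"
        using orbit_ideal_eqI[OF fin char sep b] rz J(2) w by blast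
      then show ?thesis using rz by simp
    qed
    then show ?thesis using J(2) by blast
  qed
qed

text \<open>Comparing characters turns x = \<Sum> y(L) into one independent condition per ideal, and
  each condition has exactly one solution there.\<close>

lemma separate_orbits_semisimple:
  assumes fin: "finite (carrier G)" and char: "\<not> CHAR('k::field) dvd Coset.order G"
    and sep: supports_separate_orbits
    and R: "ring (invariant_ring :: ('b \<Rightarrow> 'k) ring)"
  shows "semisimple_ring (invariant_ring :: ('b \<Rightarrow> 'k) ring)"
proof -
  define \<L> where "\<L> = (orbit_ideal ` B :: ('b \<Rightarrow> 'k) set set)"
  have fin\<L>: "finite \<L>" using finite_carrier by (simp add: \<L>_def)
  have ideal: "L \<subseteq> inv_vecs" if "L \<in> \<L>" for L
    using that by (auto simp: \<L>_def orbit_ideal_def)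
  have "\<exists>!y. y \<in> (\<Pi>\<^sub>E L\<in>\<L>. L) \<and> x = finsum invariant_ring y \<L>"
    if x: "x \<in> inv_vecs" for x :: "'b \<Rightarrow> 'k"
  proof -
    have eq_iff: "x = finsum invariant_ring y \<L>
        \<longleftrightarrow> (\<forall>b\<in>B. character b (y (orbit_ideal b)) = character b x)"
      if y: "y \<in> (\<Pi>\<^sub>E L\<in>\<L>. L)" for y
    proof -
      have yv: "y L \<in> L" "y L \<in> inv_vecs" if "L \<in> \<L>" for L
        using y that ideal by (auto simp: PiE_def)
      have fs: "finsum invariant_ring y \<L> = (\<lambda>b. \<Sum>L\<in>\<L>. y L b)"
        using finsum_invariant_ring[OF R fin\<L>] yv by blast
      have "(\<lambda>b. \<Sum>L\<in>\<L>. y L b) \<in> inv_vecs"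
        using yv unfolding inv_vecs_def vecs_def by (auto intro!: sum.neutral sum.cong)
      then have "x = finsum invariant_ring y \<L>
          \<longleftrightarrow> (\<forall>b\<in>B. character b (\<lambda>b. \<Sum>L\<in>\<L>. y L b) = character b x)"
        using characters_separate[OF fin char sep x] unfolding fs by metis
      also have "\<dots> \<longleftrightarrow> (\<forall>b\<in>B. character b (y (orbit_ideal b)) = character b x)"
      proof (rule ball_cong[OF refl])
        fix b assume b: "b \<in> B"
        have "character b (\<lambda>b. \<Sum>L\<in>\<L>. y L b) = (\<Sum>L\<in>\<L>. character b (y L))"
          unfolding character_def by (rule sum.swap)
        \<comment> \<open>Elements of the ideal of another orbit have character 0 at
          \<open>b\<close>.\<close>
        also have "\<dots> = (\<Sum>L\<in>\<L>. if L = orbit_ideal b then character b (y L) else 0)"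
        proof (rule sum.cong[OF refl])
          fix L assume L: "L \<in> \<L>"
          then obtain c where c: "c \<in> B" "L = orbit_ideal c" by (auto simp: \<L>_def)
          show "character b (y L) = (if L = orbit_ideal b then character b (y L) else 0)"
            using yv(1)[OF L] orbit_ideal_eq_iff[OF fin char sep b c(1)] c b
            by (auto simp: orbit_ideal_def)
        qed
        also have "\<dots> = character b (y (orbit_ideal b))"
          using fin\<L> b by (simp add: \<L>_def)
        finally show "character b (\<lambda>b. \<Sum>L\<in>\<L>. y L b) = character b x
            \<longleftrightarrow> character b (y (orbit_ideal b)) = character b x" by simp
      qed
      finally show ?thesis .
    qed
    have "\<exists>w. w \<in> L \<and> (\<forall>b\<in>B. L = orbit_ideal b \<longrightarrow> character b w = character b x)"
      if "L \<in> \<L>" for L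
    proof -
      obtain c where c: "c \<in> B" "L = orbit_ideal c" using \<open>L \<in> \<L>\<close> by (auto simp: \<L>_def)
      obtain w where w: "w \<in> orbit_ideal c" "character c w = character c x"
        using orbit_ideal_component[OF fin char sep c(1)] by metis
      have "character b w = character b x" if "b \<in> B" "L = orbit_ideal b" for b
      proof -
        have "b \<in> orbit G \<phi> c" using orbit_ideal_eq_iff[OF fin char sep that(1) c(1)] that c by simp
        then show ?thesis
          using character_orbit[of w c b] character_orbit[of x c b] c(1) w x
          by (simp add: orbit_ideal_def)
      qed
      then show ?thesis using w c by blast
    qed
    then obtain u where u: "\<And>L. L \<in> \<L> \<Longrightarrow> u L \<in> L"
      "\<And>L b. L \<in> \<L> \<Longrightarrow> b \<in> B \<Longrightarrow> L = orbit_ideal b \<Longrightarrow> character b (u L) = character b x"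
      by metis
    show ?thesis
    \<comment> \<open>The restriction fixes the values off \<open>\<L>\<close>, as uniqueness among
      extensional families demands.\<close>
    proof (rule ex1I[of _ "restrict u \<L>"])
      have "restrict u \<L> \<in> (\<Pi>\<^sub>E L\<in>\<L>. L)" using u by auto
      moreover have "\<forall>b\<in>B. character b (restrict u \<L> (orbit_ideal b)) = character b x"
        using u(2) by (simp add: \<L>_def)
      ultimately show "restrict u \<L> \<in> (\<Pi>\<^sub>E L\<in>\<L>. L) \<and> x = finsum invariant_ring (restrict u \<L>) \<L>"
        using eq_iff by blast
    next
      fix y assume "y \<in> (\<Pi>\<^sub>E L\<in>\<L>. L) \<and> x = finsum invariant_ring y \<L>"
      then have y: "y \<in> (\<Pi>\<^sub>E L\<in>\<L>. L)" "\<forall>b\<in>B. character b (y (orbit_ideal b)) = character b x"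
        using eq_iff by auto
      show "y = restrict u \<L>"
      proof
        fix L
        show "y L = restrict u \<L> L"
        proof (cases "L \<in> \<L>")
          case True
          then obtain c where c: "c \<in> B" "L = orbit_ideal c" by (auto simp: \<L>_def)
          have "y L \<in> orbit_ideal c" "u L \<in> orbit_ideal c"
            using y(1) u(1) True c by (auto simp: PiE_def)
          moreover have "character c (y L) = character c (u L)"
            using y(2) u(2)[OF True c] c by simp
          ultimately show ?thesis
            using orbit_ideal_eqI[OF fin char sep c(1)] True by simp
        next
          case False
          then show ?thesis using y(1) by (auto simp: PiE_def extensional_def)
        qed
      qed
    qed
  qed
  moreover have "\<forall>L\<in>\<L>. simple_left_ideal L (invariant_ring :: ('b \<Rightarrow> 'k) ring)"
    using simple_orbit_ideal[OF fin char sep _ R] by (auto simp: \<L>_def)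
  ultimately show ?thesis
    unfolding semisimple_ring_def carrier_invariant_algebra
    using R fin\<L> by (intro conjI exI[of _ \<L>] ballI) simp_all
qed

end

text \<open>The substance is that the identity is invariant: its translates are identities
  too.\<close>

lemma ring_invariant_ring:
  fixes B :: "'b set"
  assumes "connected_left_regular_band B bmul" "lrb_group_action B bmul G \<phi>"
  shows "ring (invariant_algebra B bmul G \<phi> :: ('b \<Rightarrow> 'k::field) ring)"
proof -
  interpret connected_left_regular_band B bmul by fact
  interpret lrb_group_action B bmul G \<phi> by fact
  let ?e = "one (semigroup_algebra B bmul) :: 'b \<Rightarrow> 'k"
  note e = one_semigroup_algebra[where 'k = 'k]
  have one_inv: "?e \<in> inv_vecs"
  proof -
    have "?e (\<phi> g b) = ?e b" if g: "g \<in> carrier G" and b: "b \<in> B" for g b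
    proof -
      \<comment> \<open>Set to 0 off \<open>B\<close>, where the action prescribes no meaningful
        value.\<close>
      define e' where "e' = (\<lambda>b. if b \<in> B then ?e (\<phi> g b) else 0)"
      have e': "e' \<in> vecs B" by (simp add: e'_def vecs_def)
      have "conv e' f = f" if f: "f \<in> vecs B" for f
      proof
        fix c
        \<comment> \<open>\<open>f\<close> transported by \<open>g\<close>, so that e' f at
          \<open>c\<close> becomes e h at \<open>\<phi> g c\<close>.\<close>
        define h where "h = (\<lambda>b. if b \<in> B then f (\<phi> (inv\<^bsub>G\<^esub> g) b) else 0)"
        have h: "h \<in> vecs B" "h (\<phi> g b) = f b" if "b \<in> B" for b
          using that g act_inv act_closed by (auto simp: h_def vecs_def)
        show "conv e' f c = f c"
        proof (cases "c \<in> B")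
          case True
          have "conv e' f c = conv (\<lambda>b. ?e (\<phi> g b)) (\<lambda>b. h (\<phi> g b)) c"
            unfolding conv_def using h by (intro sum.cong refl) (simp add: e'_def)
          also have "\<dots> = conv ?e h (\<phi> g c)" using conv_act[OF g True] by metis
          finally show ?thesis using e(2)[OF h(1)] h(2) True by metis
        next
          case False
          then show ?thesis using f conv_closed[of e' f] by (simp add: vecs_def)
        qed
      qed
      \<comment> \<open>A left identity equals a right identity: both are the product e' e.\<close>
      then have "e' = ?e" using e(1) e(3)[OF e'] by metis
      then show ?thesis using b by (metis e'_def)
    qed
    then show ?thesis using e(1) by (simp add: inv_vecs_def)
  qed
  have "f \<in> vecs B" if "f \<in> inv_vecs" for f :: "'b \<Rightarrow> 'k"
    using that by (simp add: inv_vecs_def)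
  moreover have neg: "\<exists>h\<in>inv_vecs. (\<lambda>b. h b + f b) = (\<lambda>b. 0)" if "f \<in> inv_vecs" for f :: "'b \<Rightarrow> 'k"
    using inv_vecs_scale[OF that, of "- 1"] by (intro bexI[of _ "\<lambda>b. - f b"]) simp_all
  ultimately show ?thesis
    using e(2,3) one_inv
    by (intro ringI abelian_groupI monoidI)
      (auto simp: carrier_invariant_algebra invariant_algebra_ops conv_inv_vecs inv_vecs_add
        inv_vecs_zero conv_assoc conv_add_left conv_add_right add_ac
        intro!: neg)
qed

theorem theorem4p7:
  fixes B :: "'b set" and bmul :: "'b \<Rightarrow> 'b \<Rightarrow> 'b"
    and G :: "('g, 'm) monoid_scheme" and \<phi> :: "'g \<Rightarrow> 'b \<Rightarrow> 'b"
  assumes "connected_left_regular_band B bmul"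
    and "finite (carrier G)"
    and "lrb_group_action B bmul G \<phi>"
    and "\<not> CHAR('k::field) dvd Coset.order G"
  shows "(semisimple_ring (invariant_algebra B bmul G \<phi> :: ('b \<Rightarrow> 'k) ring) \<longleftrightarrow>
            card (orbits G (support_semilattice B bmul) (support_action B bmul \<phi>)) =
            card (orbits G B \<phi>)) \<and>
         (card (orbits G (support_semilattice B bmul) (support_action B bmul \<phi>)) =
            card (orbits G B \<phi>) \<longleftrightarrow>
            commutative_ring (invariant_algebra B bmul G \<phi> :: ('b \<Rightarrow> 'k) ring))"
proof -
  interpret lrb_group_action B bmul G \<phi> by fact
  have R: "ring (invariant_algebra B bmul G \<phi> :: ('b \<Rightarrow> 'k) ring)"
    by (rule ring_invariant_ring[OF assms(1,3)])
  have "semisimple_ring (invariant_algebra B bmul G \<phi> :: ('b \<Rightarrow> 'k) ring)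
      \<longleftrightarrow> supports_separate_orbits"
    using semisimple_separate_orbits[OF assms(2,4)] separate_orbits_semisimple[OF assms(2,4) _ R]
    by blast
  moreover have "commutative_ring (invariant_algebra B bmul G \<phi> :: ('b \<Rightarrow> 'k) ring)
      \<longleftrightarrow> supports_separate_orbits"
    using commuting_separate_orbits[OF assms(2,4)] separate_orbits_commuting[OF assms(2,4)]
    unfolding commutative_invariant_ring_iff by blast
  ultimately show ?thesis unfolding card_orbits_eq_iff by blast
qed

end
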